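(* The function $\zeta$ which assigns to a finite poset $P=(X,\prec)$ with $|X|=n$ and a positive integer $t$ the value $$\zeta(P,t)\ :=\ \Omega(P,t)\,n!\ -\ e(P)\,t^n$$ (a nonnegative integer) is in the complexity class $\#\mathrm{P}$.
   Context: $\Omega(P,t)$ is the number of maps $g:X\to[t]$ with $g(x)\le g(y)$ whenever $x\prec y$; $e(P)$ is the number of linear extensions of $P$ (bijections $f:X\to[n]$ with $f(x)<f(y)$ whenever $x\prec y$). $\#\mathrm{P}$ is the class of functions that count the number of witnesses of a relation whose membership can be decided in polynomial time. *)

theory Defs
  imports
    "HOL-Library.FuncSet"
    "HOL-Library.Infinite_Typeclass"
    "HOL-Computational_Algebra.Polynomial"
begin

section \<open>Posets, order polynomials and linear extensions\<close>

definition finite_poset :: "'a set \<Rightarrow> 'a rel \<Rightarrow> bool" where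
  "finite_poset X r \<longleftrightarrow> finite X \<and> r \<subseteq> X \<times> X \<and> irrefl r \<and> trans r"

definition order_maps :: "'a set \<Rightarrow> 'a rel \<Rightarrow> nat \<Rightarrow> ('a \<Rightarrow> nat) set" where
  "order_maps X r t = {g \<in> X \<rightarrow>\<^sub>E {1..t}. \<forall>(x, y) \<in> r. g x \<le> g y}"

definition order_poly :: "'a set \<Rightarrow> 'a rel \<Rightarrow> nat \<Rightarrow> nat" where
  "order_poly X r t = card (order_maps X r t)"

definition linear_extensions :: "'a set \<Rightarrow> 'a rel \<Rightarrow> ('a \<Rightarrow> nat) set" where
  "linear_extensions X r =
     {f \<in> X \<rightarrow>\<^sub>E {1..card X}. bij_betw f X {1..card X} \<and> (\<forall>(x, y) \<in> r. f x < f y)}"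

definition num_linear_extensions :: "'a set \<Rightarrow> 'a rel \<Rightarrow> nat" where
  "num_linear_extensions X r = card (linear_extensions X r)"

text \<open>The difference is taken in the integers, so that it is not truncated at 0.\<close>

definition zeta :: "'a set \<times> 'a rel \<times> nat \<Rightarrow> int" where
  "zeta = (\<lambda>(X, r, t). int (order_poly X r t) * fact (card X)
             - int (num_linear_extensions X r) * int t ^ card X)"


section \<open>Deterministic multi-tape Turing machines\<close>

text \<open>
  States and tape symbols are initial segments of the natural numbers.  The start state is 0, the
  accepting state is 1 and the rejecting state is 2; symbol 0 is the blank.  A tape is two-way
  infinite and comes with the position of its head.
\<close>

datatype move = MoveLeft | Stay | MoveRight

type_synonym tape = "(int \<Rightarrow> nat) \<times> int"

type_synonym config = "nat \<times> tape list"

record machine =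
  tapes :: nat
  states :: nat
  symbols :: nat
  delta :: "nat \<Rightarrow> nat list \<Rightarrow> nat \<times> (nat \<times> move) list"

text \<open>
  The transition function is only relevant on the finitely many arguments considered here, so a
  well-formed machine is a finite object.  There are at least four symbols, because the symbols
  1, 2 and 3 are used for the input.
\<close>

definition wf_machine :: "machine \<Rightarrow> bool" where
  "wf_machine M \<longleftrightarrow> 1 \<le> tapes M \<and> 3 \<le> states M \<and> 4 \<le> symbols M \<and>
     (\<forall>q ss. q < states M \<and> length ss = tapes M \<and> set ss \<subseteq> {..<symbols M} \<longrightarrow>
        (case delta M q ss of (q', as) \<Rightarrow>
           q' < states M \<and> length as = tapes M \<and> (\<forall>(s, d) \<in> set as. s < symbols M)))"

fun shift :: "move \<Rightarrow> int" where
  "shift MoveLeft = -1"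
| "shift Stay = 0"
| "shift MoveRight = 1"

definition read_tape :: "tape \<Rightarrow> nat" where
  "read_tape = (\<lambda>(c, h). c h)"

definition act :: "tape \<Rightarrow> nat \<times> move \<Rightarrow> tape" where
  "act = (\<lambda>(c, h) (s, d). (c(h := s), h + shift d))"

definition step :: "machine \<Rightarrow> config \<Rightarrow> config" where
  "step M = (\<lambda>(q, ts).
     if q \<in> {1, 2} then (q, ts)
     else (case delta M q (map read_tape ts) of (q', as) \<Rightarrow> (q', map2 act ts as)))"

definition start :: "machine \<Rightarrow> nat list \<Rightarrow> config" where
  "start M w =
     (0, (\<lambda>i. if 0 \<le> i \<and> i < int (length w) then w ! nat i else 0, 0)
           # replicate (tapes M - 1) (\<lambda>_. 0, 0))"

text \<open>Since step fixes halting configurations, this says that M halts within T steps.\<close>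

definition decides_within :: "machine \<Rightarrow> nat list \<Rightarrow> bool \<Rightarrow> nat \<Rightarrow> bool" where
  "decides_within M w b T \<longleftrightarrow> fst ((step M ^^ T) (start M w)) = (if b then 1 else 2)"


section \<open>The class #P\<close>

text \<open>A pair of bit strings is presented to a machine as x \# y, with 3 as the separator.\<close>

definition symbol :: "bool \<Rightarrow> nat" where
  "symbol b = (if b then 2 else 1)"

definition pair_input :: "bool list \<Rightarrow> bool list \<Rightarrow> nat list" where
  "pair_input x y = map symbol x @ [3] @ map symbol y"

definition polytime_decidable :: "(bool list \<Rightarrow> bool list \<Rightarrow> bool) \<Rightarrow> bool" where
  "polytime_decidable R \<longleftrightarrow>
     (\<exists>M (p :: nat poly). wf_machine M \<and>
        (\<forall>x y. decides_within M (pair_input x y) (R x y) (poly p (length (pair_input x y)))))"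

text \<open>As usual for #P, the length of a witness is polynomially bounded in that of the input.\<close>

definition polynomially_balanced :: "(bool list \<Rightarrow> bool list \<Rightarrow> bool) \<Rightarrow> bool" where
  "polynomially_balanced R \<longleftrightarrow>
     (\<exists>p :: nat poly. \<forall>x y. R x y \<longrightarrow> length y \<le> poly p (length x))"

definition sharpP :: "(bool list \<Rightarrow> nat) set" where
  "sharpP = {F. \<exists>R. polytime_decidable R \<and> polynomially_balanced R \<and>
                    (\<forall>x. F x = card {y. R x y})}"

text \<open>
  Membership in #P for a function f on combinatorial objects that are represented by bit strings.
  An object may have several representations, on all of which the value must be that of f.
  Strings that represent nothing get the value 0.
\<close>

definition in_sharpP :: "(bool list \<Rightarrow> 'i \<Rightarrow> bool) \<Rightarrow> ('i \<Rightarrow> int) \<Rightarrow> bool" where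
  "in_sharpP rep f \<longleftrightarrow>
     (\<exists>F \<in> sharpP. (\<forall>w i. rep w i \<longrightarrow> int (F w) = f i) \<and>
                     (\<forall>w. (\<nexists>i. rep w i) \<longrightarrow> F w = 0))"


section \<open>Representation of a poset and a positive integer\<close>

text \<open>Binary digits, least significant digit first, without leading zeros.\<close>

fun binary :: "nat \<Rightarrow> bool list" where
  "binary t = (if t = 0 then [] else odd t # binary (t div 2))"

declare binary.simps [simp del]

text \<open>
  With respect to an enumeration xs of the n elements: n in unary, a delimiter, the
  incidence matrix of the order relation row by row, and t in binary.
\<close>

definition encode :: "'a list \<Rightarrow> 'a rel \<Rightarrow> nat \<Rightarrow> bool list" where
  "encode xs r t =
     replicate (length xs) True @ [False] @
     concat (map (\<lambda>x. map (\<lambda>y. (x, y) \<in> r) xs) xs) @ binary t"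

definition represents :: "bool list \<Rightarrow> 'a set \<times> 'a rel \<times> nat \<Rightarrow> bool" where
  "represents w = (\<lambda>(X, r, t). finite_poset X r \<and> 1 \<le> t \<and>
     (\<exists>xs. distinct xs \<and> set xs = X \<and> w = encode xs r t))"

lemma ex_represents:
  assumes "finite_poset X r" "1 \<le> t"
  shows "\<exists>w. represents w (X, r, t)"
  using assms finite_distinct_list[of X]
  by (auto simp: represents_def finite_poset_def)

end

(*
Let tau range over the bijections X -> [n].  A pair (g, tau) of an order preserving map g and a
bijection tau such that tau x < tau y whenever x < y in the poset and g x = g y orders X
lexicographically, and this order together with the function g o tau^-1 on [n] determines the pair.
So there are e(P) t^n such pairs among all Omega(P, t) n! pairs, and zeta(P, t) counts the others:
those with x < y in the poset, g x = g y and tau y < tau x for some x and y.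

Whether a bit string encodes such a pair is expressible by a first-order formula over the positions
of the string with addition and multiplication.  Such formulas can be evaluated by a multi-tape
machine that keeps a copy of the input on every tape and uses the head positions as counters.
*)

theory Submission
  imports Defs
begin

section \<open>A combinatorial interpretation of zeta\<close>

text \<open>The labeling \<tau> pays for both factors at once: it accounts for n! and it breaks the
  ties of g, so the verifier never has to single out a linear extension. The values of g go up to t,
  which can be exponential in the length of its binary notation. They therefore never become head
  positions: those hold only indices of elements and digits, and values are compared digit by digit
  (\<open>bits_less\<close>). Time stays polynomial because a fixed formula has a fixed number of
  quantifiers, each running through \<open>length w + 1\<close> positions, and its terms have degree
  at most two. #P counts strings, so every pair needs exactly one string. Hence each value gets a
  fixed number of digits, and each row of the permutation matrix exactly one mark. Strings that
  represent nothing must count 0, so the formula also checks the input; conversely an accepted input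
  must represent something, which requires carrier sets of every finite size.\<close>

definition labelings :: "'a set \<Rightarrow> ('a \<Rightarrow> nat) set" where
  "labelings X = {\<tau> \<in> X \<rightarrow>\<^sub>E {1..card X}. bij_betw \<tau> X {1..card X}}"

definition violations :: "'a set \<Rightarrow> 'a rel \<Rightarrow> nat \<Rightarrow> (('a \<Rightarrow> nat) \<times> ('a \<Rightarrow> nat)) set" where
  "violations X r t = {(g, \<tau>) \<in> order_maps X r t \<times> labelings X. \<exists>(x, y) \<in> r. g x = g y \<and> \<tau> y < \<tau> x}"

text \<open>Domain and range are finite of equal size. This reduces the counting of labelings to
  counting injections, and it leaves the verifier only injectivity to check.\<close>

lemma labelings_eq_inj:
  assumes "finite X"
  shows "labelings X = {\<tau> \<in> X \<rightarrow>\<^sub>E {1..card X}. inj_on \<tau> X}"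
proof -
  have "bij_betw \<tau> X {1..card X} \<longleftrightarrow> inj_on \<tau> X" if "\<tau> \<in> X \<rightarrow>\<^sub>E {1..card X}" for \<tau>
  proof
    assume "inj_on \<tau> X"
    moreover from this have "\<tau> ` X = {1..card X}"
      using that by (intro card_subset_eq) (auto simp: card_image)
    ultimately show "bij_betw \<tau> X {1..card X}" by (simp add: bij_betw_def)
  qed (simp add: bij_betw_def)
  then show ?thesis unfolding labelings_def by auto
qed

lemma card_labelings: "finite X \<Longrightarrow> card (labelings X) = fact (card X)"
  using card_inj_on_subset_funcset[of X "{1..card X}" X]
  by (simp add: labelings_eq_inj fact_prod_rev)

text \<open>The stable sorting permutation of \<open>h\<close>: \<sigma> k counts the indices whose
  key is at most that of k, with ties of \<open>h\<close> broken by the index.\<close>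

lemma ex_rank:
  fixes h :: "nat \<Rightarrow> nat"
  shows "\<exists>\<sigma>. bij_betw \<sigma> {1..n} {1..n} \<and>
    (\<forall>k\<in>{1..n}. \<forall>l\<in>{1..n}. \<sigma> k < \<sigma> l \<longleftrightarrow> h k < h l \<or> h k = h l \<and> k < l)"
proof -
  \<comment> \<open>The factor n + 1 exceeds every index in {1..n}, so one number encodes the
    lexicographic order of (h k, k).\<close>
  define \<kappa> where "\<kappa> k = h k * (n + 1) + k" for k
  define \<sigma> where "\<sigma> k = card {j \<in> {1..n}. \<kappa> j \<le> \<kappa> k}" for k
  have less: "\<kappa> k < \<kappa> l" if "h k < h l" "k \<in> {1..n}" for k l
  proof -
    have "Suc (h k) * (n + 1) \<le> h l * (n + 1)" using that(1) by (intro mult_le_mono) auto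
    then show ?thesis using that(2) by (simp add: \<kappa>_def)
  qed
  have \<kappa>: "\<kappa> k < \<kappa> l \<longleftrightarrow> h k < h l \<or> h k = h l \<and> k < l" if "k \<in> {1..n}" "l \<in> {1..n}" for k l
    using less[of k l] less[of l k] that by (cases "h k" "h l" rule: linorder_cases) (auto simp: \<kappa>_def)
  have mono: "\<sigma> k \<le> \<sigma> l" if "\<kappa> k \<le> \<kappa> l" for k l
    unfolding \<sigma>_def using that by (intro card_mono) auto
  have strict: "\<sigma> k < \<sigma> l" if "\<kappa> k < \<kappa> l" "l \<in> {1..n}" for k l
  proof -
    have "l \<in> {j \<in> {1..n}. \<kappa> j \<le> \<kappa> l} - {j \<in> {1..n}. \<kappa> j \<le> \<kappa> k}" using that by auto
    moreover have "{j \<in> {1..n}. \<kappa> j \<le> \<kappa> k} \<subseteq> {j \<in> {1..n}. \<kappa> j \<le> \<kappa> l}" using that(1) by auto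
    ultimately have "{j \<in> {1..n}. \<kappa> j \<le> \<kappa> k} \<subset> {j \<in> {1..n}. \<kappa> j \<le> \<kappa> l}" by blast
    then show ?thesis unfolding \<sigma>_def by (intro psubset_card_mono) auto
  qed
  have iff: "\<sigma> k < \<sigma> l \<longleftrightarrow> \<kappa> k < \<kappa> l" if "k \<in> {1..n}" "l \<in> {1..n}" for k l
    using mono[of l k] strict[of k l] that by fastforce
  have "inj_on \<sigma> {1..n}"
  proof (rule inj_onI)
    fix k l assume kl: "k \<in> {1..n}" "l \<in> {1..n}" "\<sigma> k = \<sigma> l"
    then have "\<not> \<kappa> k < \<kappa> l" "\<not> \<kappa> l < \<kappa> k"
      using iff[OF kl(1,2)] iff[OF kl(2,1)] by auto
    then show "k = l" using \<kappa>[OF kl(1,2)] \<kappa>[OF kl(2,1)] by auto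
  qed
  moreover have "\<sigma> ` {1..n} \<subseteq> {1..n}"
  proof (intro image_subsetI)
    fix k assume "k \<in> {1..n}"
    then have "{k} \<subseteq> {j \<in> {1..n}. \<kappa> j \<le> \<kappa> k}" by auto
    from card_mono[OF _ this] have "1 \<le> \<sigma> k" by (simp add: \<sigma>_def)
    moreover have "\<sigma> k \<le> card {1..n}" unfolding \<sigma>_def by (intro card_mono) auto
    ultimately show "\<sigma> k \<in> {1..n}" by simp
  qed
  ultimately have "bij_betw \<sigma> {1..n} {1..n}" by (simp add: bij_betw_def endo_inj_surj)
  then show ?thesis using iff \<kappa> by blast
qed

text \<open>
  A pair (g, tau) without violation corresponds to the function h = g o tau^-1 together with the
  linear extension that orders the elements x lexicographically by (g x, tau x).
\<close>

lemma card_lexicographic_pairs: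
  assumes "finite_poset X r"
  shows "card {(g, \<tau>) \<in> order_maps X r t \<times> labelings X. \<forall>(x, y) \<in> r. g x = g y \<longrightarrow> \<tau> x < \<tau> y} =
    num_linear_extensions X r * t ^ card X" (is "card ?S = _")
proof -
  note One_nat_def [simp del]
  let ?n = "card X"
  let ?N = "{1..?n}"
  have X: "finite X" "r \<subseteq> X \<times> X" using assms by (auto simp: finite_poset_def)
  define \<sigma> where "\<sigma> h = (SOME \<sigma>. bij_betw \<sigma> ?N ?N \<and>
    (\<forall>k\<in>?N. \<forall>l\<in>?N. \<sigma> k < \<sigma> l \<longleftrightarrow> h k < h l \<or> h k = h l \<and> k < l))" for h :: "nat \<Rightarrow> nat"
  note \<sigma> = someI_ex[OF ex_rank[of ?n], folded \<sigma>_def]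
  have \<sigma>_bij: "bij_betw (\<sigma> h) ?N ?N" for h
    using \<sigma>[of h] by (rule conjunct1)
  have \<sigma>_less: "\<sigma> h k < \<sigma> h l \<longleftrightarrow> h k < h l \<or> h k = h l \<and> k < l" if "k \<in> ?N" "l \<in> ?N" for h k l
    using \<sigma>[of h, THEN conjunct2, THEN bspec, THEN bspec, OF that] .
  \<comment> \<open>The permutation \<open>\<sigma> h\<close> depends on h alone. So
    \<open>G\<close> can undo it on f to recover \<tau> first, and then obtain g as h after \<tau>.
    The restrictions to X and [n] keep all maps extensional.\<close>
  define F where "F = (\<lambda>(g, \<tau>). let h = restrict (g \<circ> inv_into X \<tau>) ?N in (restrict (\<sigma> h \<circ> \<tau>) X, h))"
  define G where "G = (\<lambda>(f, h). let \<tau> = restrict (inv_into ?N (\<sigma> h) \<circ> f) X in (restrict (h \<circ> \<tau>) X, \<tau>))"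
  let ?LE = "linear_extensions X r" and ?H = "?N \<rightarrow>\<^sub>E {1..t}"
  have LE: "f \<in> ?LE \<longleftrightarrow> f \<in> labelings X \<and> (\<forall>(x, y) \<in> r. f x < f y)" for f
    by (auto simp: linear_extensions_def labelings_def)
  have lab: "restrict (\<pi> \<circ> \<tau>) X \<in> labelings X" if "bij_betw \<pi> ?N ?N" "\<tau> \<in> labelings X" for \<pi> \<tau>
  proof -
    have "bij_betw (\<pi> \<circ> \<tau>) X ?N" using that by (auto simp: labelings_def intro: bij_betw_trans)
    moreover have "bij_betw (restrict (\<pi> \<circ> \<tau>) X) X ?N \<longleftrightarrow> bij_betw (\<pi> \<circ> \<tau>) X ?N"
      by (intro bij_betw_cong) auto
    ultimately show ?thesis by (auto simp: labelings_def dest: bij_betw_apply)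
  qed
  have inv: "inv_into X \<tau> k \<in> X" "\<tau> (inv_into X \<tau> k) = k" if "\<tau> \<in> labelings X" "k \<in> ?N" for \<tau> k
    using that by (auto simp: labelings_def bij_betw_def intro: inv_into_into f_inv_into_f)
  have inv': "inv_into X \<tau> (\<tau> x) = x" "\<tau> x \<in> ?N" if "\<tau> \<in> labelings X" "x \<in> X" for \<tau> x
    using that by (auto simp: labelings_def bij_betw_def)
  have \<sigma>_inv: "inv_into ?N (\<sigma> h) (\<sigma> h k) = k" "\<sigma> h (inv_into ?N (\<sigma> h) k) = k" if "k \<in> ?N" for h k
    using that \<sigma>_bij[of h] by (simp_all add: bij_betw_inv_into_left bij_betw_inv_into_right)
  \<comment> \<open>The heart of the correspondence: being a linear extension after ranking splits,
    on each related pair, into monotonicity of g and the correct order of \<tau> on ties.\<close>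
  have lex: "(\<forall>(x, y) \<in> r. \<sigma> h (\<tau> x) < \<sigma> h (\<tau> y)) \<longleftrightarrow>
      (\<forall>(x, y) \<in> r. g x \<le> g y) \<and> (\<forall>(x, y) \<in> r. g x = g y \<longrightarrow> \<tau> x < \<tau> y)"
    if "\<tau> \<in> labelings X" "\<And>x. x \<in> X \<Longrightarrow> h (\<tau> x) = g x" for h g \<tau>
  proof -
    have "\<sigma> h (\<tau> x) < \<sigma> h (\<tau> y) \<longleftrightarrow> g x \<le> g y \<and> (g x = g y \<longrightarrow> \<tau> x < \<tau> y)" if "(x, y) \<in> r" for x y
    proof -
      have "x \<in> X" "y \<in> X" using that X by auto
      then show ?thesis
        using \<sigma>_less[of "\<tau> x" "\<tau> y" h] inv'(2)[of \<tau>] \<open>\<tau> \<in> labelings X\<close> \<open>\<And>x. x \<in> X \<Longrightarrow> h (\<tau> x) = g x\<close>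
        by auto
    qed
    then show ?thesis by blast
  qed
  have "bij_betw F ?S (?LE \<times> ?H)"
  proof (rule bij_betw_byWitness[where f' = G])
    show "\<forall>a\<in>?S. G (F a) = a"
    proof (intro ballI, clarify)
      fix g \<tau> assume g: "g \<in> order_maps X r t" and \<tau>: "\<tau> \<in> labelings X"
      define h where "h = restrict (g \<circ> inv_into X \<tau>) ?N"
      have "restrict (inv_into ?N (\<sigma> h) \<circ> restrict (\<sigma> h \<circ> \<tau>) X) X = \<tau>"
        using \<tau> inv'(2)[OF \<tau>]
        by (intro extensionalityI[of _ X]) (auto simp: \<sigma>_inv labelings_def PiE_def)
      moreover have "restrict (h \<circ> \<tau>) X = g"
        using g inv'[OF \<tau>]
        by (intro extensionalityI[of _ X]) (auto simp: h_def order_maps_def PiE_def)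
      ultimately show "G (F (g, \<tau>)) = (g, \<tau>)"
        by (simp add: F_def G_def Let_def flip: h_def)
    qed
    show "\<forall>a\<in>?LE \<times> ?H. F (G a) = a"
    proof (intro ballI, clarify)
      fix f h assume f: "f \<in> ?LE" and h: "h \<in> ?H"
      define \<tau> where "\<tau> = restrict (inv_into ?N (\<sigma> h) \<circ> f) X"
      have \<tau>: "\<tau> \<in> labelings X"
        unfolding \<tau>_def using f by (intro lab bij_betw_inv_into \<sigma>_bij) (auto simp: LE)
      have h': "restrict (restrict (h \<circ> \<tau>) X \<circ> inv_into X \<tau>) ?N = h"
        using h inv[OF \<tau>] by (intro extensionalityI[of _ ?N]) (auto simp: PiE_def)
      have "restrict (\<sigma> h \<circ> \<tau>) X = f"
        using f inv'(2)[of f] unfolding LE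
        by (intro extensionalityI[of _ X]) (auto simp: \<tau>_def \<sigma>_inv labelings_def PiE_def)
      then show "F (G (f, h)) = (f, h)"
        by (simp add: F_def G_def Let_def h' flip: \<tau>_def)
    qed
    show "F ` ?S \<subseteq> ?LE \<times> ?H"
    proof (intro image_subsetI, clarify)
      fix g \<tau> assume g: "g \<in> order_maps X r t" and \<tau>: "\<tau> \<in> labelings X"
        and lt: "\<forall>(x, y) \<in> r. g x = g y \<longrightarrow> \<tau> x < \<tau> y"
      define h where "h = restrict (g \<circ> inv_into X \<tau>) ?N"
      have "h (\<tau> x) = g x" if "x \<in> X" for x using inv'[OF \<tau> that] by (simp add: h_def)
      moreover have "(\<forall>(x, y) \<in> r. g x \<le> g y)" using g by (simp add: order_maps_def)
      ultimately have "\<forall>(x, y) \<in> r. \<sigma> h (\<tau> x) < \<sigma> h (\<tau> y)" using lex[OF \<tau>, of h g] lt by blast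
      then have "restrict (\<sigma> h \<circ> \<tau>) X \<in> ?LE"
        unfolding LE using X(2) lab[OF \<sigma>_bij \<tau>] by auto
      moreover have "h \<in> ?H" using g inv[OF \<tau>] by (auto simp: h_def order_maps_def)
      ultimately show "F (g, \<tau>) \<in> ?LE \<times> ?H" by (simp add: F_def Let_def flip: h_def)
    qed
    show "G ` (?LE \<times> ?H) \<subseteq> ?S"
    proof (rule image_subsetI)
      fix p assume "p \<in> ?LE \<times> ?H"
      then obtain f h where p: "p = (f, h)" and f: "f \<in> ?LE" and h: "h \<in> ?H" by (rule SigmaE)
      define \<tau> where "\<tau> = restrict (inv_into ?N (\<sigma> h) \<circ> f) X"
      define g where "g = restrict (h \<circ> \<tau>) X"
      have \<tau>: "\<tau> \<in> labelings X"
        unfolding \<tau>_def using f by (intro lab bij_betw_inv_into \<sigma>_bij) (auto simp: LE)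
      have "\<sigma> h (\<tau> x) = f x" if "x \<in> X" for x
        using that f inv'(2)[of f x] by (simp add: \<tau>_def \<sigma>_inv LE)
      moreover have "\<forall>(x, y) \<in> r. f x < f y" using f by (simp add: LE)
      ultimately have "\<forall>(x, y) \<in> r. \<sigma> h (\<tau> x) < \<sigma> h (\<tau> y)" using X(2) by fastforce
      then have "(\<forall>(x, y) \<in> r. g x \<le> g y) \<and> (\<forall>(x, y) \<in> r. g x = g y \<longrightarrow> \<tau> x < \<tau> y)"
        using lex[OF \<tau>, of h g] by (simp add: g_def)
      moreover have "g \<in> X \<rightarrow>\<^sub>E {1..t}" using h inv'(2)[OF \<tau>] by (auto simp: g_def)
      ultimately show "G p \<in> ?S"
        using \<tau> unfolding p by (simp add: G_def Let_def order_maps_def flip: \<tau>_def g_def)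
    qed
  qed
  then have "card ?S = card ?LE * card ?H"
    by (simp add: bij_betw_same_card card_cartesian_product)
  then show ?thesis by (simp add: card_funcsetE num_linear_extensions_def)
qed

text \<open>Complementary counting inside the product of all order preserving maps with all
  labelings. Nonnegativity of \<open>zeta\<close> comes for free.\<close>

theorem zeta_eq_card_violations:
  assumes "finite_poset X r"
  shows "zeta (X, r, t) = int (card (violations X r t))"
proof -
  let ?A = "order_maps X r t \<times> labelings X"
  let ?S = "{(g, \<tau>) \<in> ?A. \<forall>(x, y) \<in> r. g x = g y \<longrightarrow> \<tau> x < \<tau> y}"
  have X: "finite X" "r \<subseteq> X \<times> X" "irrefl r" using assms by (auto simp: finite_poset_def)
  have "finite (X \<rightarrow>\<^sub>E {1..m})" for m :: nat using X(1) by (intro finite_PiE) auto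
  then have fin: "finite ?A"
    unfolding order_maps_def labelings_def by (intro finite_cartesian_product) (auto intro: finite_subset)
  \<comment> \<open>Irreflexivity and injectivity exclude equal labels on related elements, so the
    negation of \<tau> x < \<tau> y is a genuine inversion.\<close>
  have neq: "\<tau> x \<noteq> \<tau> y" if "\<tau> \<in> labelings X" "(x, y) \<in> r" for \<tau> x y
  proof -
    have "x \<in> X" "y \<in> X" "x \<noteq> y" using that(2) X(2,3) by (auto simp: irrefl_def)
    moreover have "inj_on \<tau> X" using that(1) by (simp add: labelings_def bij_betw_def)
    ultimately show ?thesis by (simp add: inj_on_eq_iff)
  qed
  have viol: "(\<exists>(x, y) \<in> r. g x = g y \<and> \<tau> y < \<tau> x) \<longleftrightarrow> \<not> (\<forall>(x, y) \<in> r. g x = g y \<longrightarrow> \<tau> x < \<tau> y)"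
    if "\<tau> \<in> labelings X" for g :: "'a \<Rightarrow> nat" and \<tau>
  proof -
    have "\<tau> y < \<tau> x \<longleftrightarrow> \<not> \<tau> x < \<tau> y" if "(x, y) \<in> r" for x y
      using neq[OF \<open>\<tau> \<in> labelings X\<close> that] by auto
    then show ?thesis by fast
  qed
  have "(g, \<tau>) \<in> violations X r t \<longleftrightarrow> (g, \<tau>) \<in> ?A - ?S" for g \<tau>
    using viol[of \<tau> g] by (cases "\<tau> \<in> labelings X"; cases "g \<in> order_maps X r t") (simp_all add: violations_def)
  then have "violations X r t = ?A - ?S" by (simp only: set_eq_iff split_paired_All simp_thms)
  then have "card ?A = card (violations X r t) + card ?S"
  proof -
    have S: "?S \<subseteq> ?A" by auto
    from card_Diff_subset[OF finite_subset[OF S fin] S] card_mono[OF fin S] show ?thesis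
      by (simp only: \<open>violations X r t = ?A - ?S\<close>)
  qed
  then have "order_poly X r t * fact (card X) =
      card (violations X r t) + num_linear_extensions X r * t ^ card X"
    using card_lexicographic_pairs[OF assms, of t] card_labelings[OF X(1)]
    by (simp add: card_cartesian_product order_poly_def)
  from arg_cong[OF this, of int] show ?thesis by (simp add: zeta_def)
qed

section \<open>Structured programs for Turing machines\<close>

text \<open>The program still to be executed serves as the control state, and each small step of a
  program is one machine step. Program running times are thus machine running times up to a
  constant. Tests see only the symbols under the heads, as a transition function does.\<close>

datatype com =
    Skip
  | Act "nat list \<Rightarrow> (nat \<times> move) list"
  | Seq com com
  | Cond "nat list \<Rightarrow> bool" com com
  | Loop "nat list \<Rightarrow> bool" com

definition idle :: "nat list \<Rightarrow> (nat \<times> move) list" where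
  "idle ss = map (\<lambda>s. (s, Stay)) ss"

fun nxt :: "com \<Rightarrow> nat list \<Rightarrow> com \<times> (nat \<times> move) list" where
  "nxt Skip ss = (Skip, idle ss)"
| "nxt (Act f) ss = (Skip, f ss)"
| "nxt (Seq c d) ss =
     (if c = Skip then (d, idle ss) else (Seq (fst (nxt c ss)) d, snd (nxt c ss)))"
| "nxt (Cond b c d) ss = (if b ss then c else d, idle ss)"
| "nxt (Loop b c) ss = (if b ss then Seq c (Loop b c) else Skip, idle ss)"

definition cstep :: "com \<times> tape list \<Rightarrow> com \<times> tape list" where
  "cstep = (\<lambda>(c, ts). (fst (nxt c (map read_tape ts)),
                       map2 act ts (snd (nxt c (map read_tape ts)))))"

text \<open>Unrolling a loop produces only \<open>Seq r (Loop b c)\<close> with \<open>r\<close> a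
  residual of the body. Hence finitely many programs can arise during a run, and they can be
  numbered as machine states.\<close>

fun residuals :: "com \<Rightarrow> com set" where
  "residuals Skip = {Skip}"
| "residuals (Act f) = {Act f, Skip}"
| "residuals (Seq c d) = (\<lambda>r. Seq r d) ` residuals c \<union> residuals d"
| "residuals (Cond b c d) = {Cond b c d} \<union> residuals c \<union> residuals d"
| "residuals (Loop b c) = {Loop b c, Skip} \<union> (\<lambda>r. Seq r (Loop b c)) ` residuals c"

lemma finite_residuals: "finite (residuals c)"
  by (induction c) auto

lemma self_in_residuals: "c \<in> residuals c"
  by (induction c) auto

lemma nxt_in_residuals: "r \<in> residuals c \<Longrightarrow> fst (nxt r ss) \<in> residuals c"
  by (induction c arbitrary: r) (auto simp: self_in_residuals split: if_splits)

fun wf_com :: "nat \<Rightarrow> nat \<Rightarrow> com \<Rightarrow> bool" where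
  "wf_com k m Skip \<longleftrightarrow> True"
| "wf_com k m (Act f) \<longleftrightarrow> (\<forall>ss. length ss = k \<and> set ss \<subseteq> {..<m} \<longrightarrow>
     length (f ss) = k \<and> fst ` set (f ss) \<subseteq> {..<m})"
| "wf_com k m (Seq c d) \<longleftrightarrow> wf_com k m c \<and> wf_com k m d"
| "wf_com k m (Cond b c d) \<longleftrightarrow> wf_com k m c \<and> wf_com k m d"
| "wf_com k m (Loop b c) \<longleftrightarrow> wf_com k m c"

lemma wf_com_residuals: "wf_com k m c \<Longrightarrow> r \<in> residuals c \<Longrightarrow> wf_com k m r"
proof (induction c arbitrary: r)
  case (Act f)
  then have "r = Act f \<or> r = Skip" by simp
  with Act.prems(1) show ?case by (metis wf_com.simps(1))
next
  case (Seq c d)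
  have "wf_com k m c" "wf_com k m d" using Seq.prems(1) by simp_all
  note IH = Seq.IH(1)[OF this(1)] Seq.IH(2)[OF this(2)] this(2)
  show ?case using Seq.prems(2) by (auto simp: IH)
next
  case (Cond b c d)
  have "wf_com k m c" "wf_com k m d" using Cond.prems(1) by simp_all
  note IH = Cond.IH(1)[OF this(1)] Cond.IH(2)[OF this(2)] this
  show ?case using Cond.prems(2) by (auto simp: IH)
next
  case (Loop b c)
  have "wf_com k m c" using Loop.prems(1) by simp
  note IH = Loop.IH[OF this] this
  show ?case using Loop.prems(2) by (auto simp: IH)
qed simp

lemma idle_wf: "length (idle ss) = length ss" "fst ` set (idle ss) = set ss"
  by (auto simp: idle_def image_image)

lemma nxt_wf:
  assumes "wf_com k m c" "length ss = k" "set ss \<subseteq> {..<m}"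
  shows "length (snd (nxt c ss)) = k \<and> fst ` set (snd (nxt c ss)) \<subseteq> {..<m}"
  using assms(1)
proof (induction c)
  case (Act f)
  then show ?case using assms(2,3) by simp
qed (use assms(2,3) in \<open>simp_all add: idle_wf\<close>)

lemma act_idle: "map2 act ts (idle (map read_tape ts)) = ts"
  by (induction ts) (auto simp: idle_def act_def read_tape_def)

text \<open>As \<open>Skip\<close> idles forever, \<open>n\<close> is an upper bound on the running
  time rather than its exact value.\<close>

definition runs :: "com \<Rightarrow> tape list \<Rightarrow> nat \<Rightarrow> tape list \<Rightarrow> bool" where
  "runs c ts n ts' \<longleftrightarrow> (cstep ^^ n) (c, ts) = (Skip, ts')"

text \<open>
  The states of the assembled machine are the residual programs, numbered from 3 on; state 0 only
  passes control to the whole program, because a numbering need not map it to 0.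
\<close>

definition assemble :: "nat \<Rightarrow> nat \<Rightarrow> (nat list \<Rightarrow> bool) \<Rightarrow> com \<Rightarrow> (com \<Rightarrow> nat) \<Rightarrow> machine" where
  "assemble k m b p num =
     \<lparr>tapes = k, states = card (residuals p) + 3, symbols = m,
      delta = (\<lambda>q ss.
        if q = 0 then (3 + num p, idle ss)
        else if q < 3 then (q, idle ss)
        else (case inv_into (residuals p) num (q - 3) of c \<Rightarrow>
          if c = Skip then (if b ss then 1 else 2, idle ss)
          else (3 + num (fst (nxt c ss)), snd (nxt c ss))))\<rparr>"

lemma wf_assemble:
  assumes num: "bij_betw num (residuals p) {0..<card (residuals p)}"
    and wf: "wf_com k m p" and "1 \<le> k" "4 \<le> m"
  shows "wf_machine (assemble k m b p num)"
proof -
  define r where "r q = inv_into (residuals p) num (q - 3)" for q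
  have r: "r q \<in> residuals p" if "3 \<le> q" "q < card (residuals p) + 3" for q
    unfolding r_def using num that by (intro inv_into_into) (auto simp: bij_betw_def)
  have n: "num c < card (residuals p)" if "c \<in> residuals p" for c
    using num that by (auto dest: bij_betw_apply)
  have pair: "(\<forall>(s, d)\<in>set as. s < m) \<longleftrightarrow> fst ` set as \<subseteq> {..<m}" for as :: "(nat \<times> move) list"
    by auto
  have w: "length (snd (nxt (r q) ss)) = k" "fst ` set (snd (nxt (r q) ss)) \<subseteq> {..<m}"
    if "3 \<le> q" "q < card (residuals p) + 3" "length ss = k" "set ss \<subseteq> {..<m}" for q ss
    using nxt_wf[OF wf_com_residuals[OF wf r] that(3,4)] that by auto
  show ?thesis
    unfolding wf_machine_def assemble_def r_def[symmetric]
    using assms(3,4) n[OF self_in_residuals]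
    by (simp add: pair idle_wf Let_def split: if_splits)
       (auto simp: idle_wf w n nxt_in_residuals r)
qed

lemma step_halted: "fst c \<in> {1, 2} \<Longrightarrow> (step M ^^ n) c = c"
  by (induction n) (auto simp: step_def split: prod.splits)

text \<open>Machine and program proceed in lockstep; the additional step is taken at
  \<open>Skip\<close>, where \<open>b\<close> reads the verdict off the final symbols. A program
  that finishes early leaves the machine in a halting state, which \<open>step\<close>
  preserves.\<close>

lemma assemble_simulates:
  assumes num: "bij_betw num (residuals p) {0..<card (residuals p)}"
    and "runs c ts n ts'" "c \<in> residuals p"
  shows "fst ((step (assemble k m b p num) ^^ Suc n) (3 + num c, ts)) =
           (if b (map read_tape ts') then 1 else 2)"
  using assms(2,3)
proof (induction n arbitrary: c ts)
  case 0
  then show ?case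
    using num by (auto simp: runs_def step_def assemble_def act_idle bij_betw_def)
next
  case (Suc n)
  let ?M = "assemble k m b p num"
  have dec: "inv_into (residuals p) num (num c) = c"
    using num Suc.prems by (auto simp: bij_betw_def)
  have "(cstep ^^ n) (cstep (c, ts)) = (Skip, ts')"
    using Suc.prems(1) by (simp add: runs_def funpow_swap1)
  then have r: "runs (fst (nxt c (map read_tape ts))) (map2 act ts (snd (nxt c (map read_tape ts)))) n ts'"
    by (simp add: runs_def cstep_def)
  show ?case
  proof (cases "c = Skip")
    case True
    have "runs Skip ts n ts'" using r True by (simp add: act_idle)
    have "(cstep ^^ n) (Skip, ts) = (Skip, ts)"
      by (induction n) (auto simp: cstep_def act_idle)
    then have [simp]: "ts' = ts" using \<open>runs Skip ts n ts'\<close> by (simp add: runs_def)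
    have s: "step ?M (3 + num c, ts) = (if b (map read_tape ts) then 1 else 2, ts)"
      using dec True by (simp add: step_def assemble_def act_idle)
    have "(step ?M ^^ Suc n) (if b (map read_tape ts) then 1 else 2, ts) = (if b (map read_tape ts) then 1 else 2, ts)"
      by (rule step_halted) simp
    then show ?thesis
      by (simp only: funpow_Suc_right o_apply s fst_conv \<open>ts' = ts\<close>)
  next
    case False
    have s: "step ?M (3 + num c, ts) =
        (3 + num (fst (nxt c (map read_tape ts))), map2 act ts (snd (nxt c (map read_tape ts))))"
      by (simp add: step_def assemble_def dec False split: prod.splits)
    show ?thesis
      using Suc.IH[OF r nxt_in_residuals[OF Suc.prems(2)]]
      by (simp only: funpow_Suc_right o_apply s)
  qed
qed

text \<open>The two extra steps are the departure from state 0 and the verdict at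
  \<open>Skip\<close>.\<close>

theorem com_machine:
  assumes "wf_com k m p" "1 \<le> k" "4 \<le> m"
  obtains M where "wf_machine M" "tapes M = k"
    "\<And>w n ts'. runs p (snd (start M w)) n ts' \<Longrightarrow> decides_within M w (b (map read_tape ts')) (n + 2)"
proof -
  obtain num where num: "bij_betw num (residuals p) {0..<card (residuals p)}"
    using ex_bij_betw_finite_nat[OF finite_residuals] by blast
  let ?M = "assemble k m b p num"
  have "decides_within ?M w (b (map read_tape ts')) (n + 2)"
    if r: "runs p (snd (start ?M w)) n ts'" for w n ts'
  proof -
    have s: "step ?M (start ?M w) = (3 + num p, snd (start ?M w))"
      by (simp add: start_def step_def assemble_def act_idle del: list.map)
    have "(step ?M ^^ (n + 2)) (start ?M w) = (step ?M ^^ Suc n) (3 + num p, snd (start ?M w))"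
      by (simp add: funpow_Suc_right[of "Suc n"] s del: funpow.simps)
    then show ?thesis
      using assemble_simulates[OF num r self_in_residuals, of k m b]
      by (simp only: decides_within_def)
  qed
  then show thesis
    using that wf_assemble[OF num assms, of b] by (simp add: assemble_def)
qed

section \<open>Running-time rules for the program constructs\<close>

lemma runs_Skip: "runs Skip ts n ts"
  by (induction n) (auto simp: runs_def cstep_def act_idle)

lemma runs_Suc:
  "runs c ts (Suc n) ts' \<longleftrightarrow>
     runs (fst (nxt c (map read_tape ts))) (map2 act ts (snd (nxt c (map read_tape ts)))) n ts'"
  by (simp add: runs_def cstep_def funpow_swap1)

lemma runs_mono: "runs c ts n ts' \<Longrightarrow> n \<le> n' \<Longrightarrow> runs c ts n' ts'"
  using runs_Skip[of ts' "n' - n"] funpow_add[of "n' - n" n cstep]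
  by (simp add: runs_def)

lemma runs_Act: "map2 act ts (f (map read_tape ts)) = ts' \<Longrightarrow> runs (Act f) ts 1 ts'"
  by (simp add: runs_def cstep_def)

text \<open>The extra step discards the finished \<open>Skip\<close> in front of
  \<open>d\<close>.\<close>

lemma runs_Seq:
  "runs c ts n ts1 \<Longrightarrow> runs d ts1 m ts2 \<Longrightarrow> runs (Seq c d) ts (n + m + 1) ts2"
proof (induction n arbitrary: c ts)
  case 0
  then show ?case
    by (simp add: runs_Suc act_idle) (simp add: runs_def act_idle)
next
  case (Suc n)
  show ?case
  proof (cases "c = Skip")
    case True
    then have "ts1 = ts" using Suc.prems(1) runs_Skip[of ts "Suc n"] by (simp add: runs_def)
    with True show ?thesis
      using runs_mono[OF Suc.prems(2), of "Suc n + m"] by (simp add: runs_Suc act_idle)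
  next
    case False
    have "runs (fst (nxt c (map read_tape ts))) (map2 act ts (snd (nxt c (map read_tape ts)))) n ts1"
      using Suc.prems(1) by (simp only: runs_Suc)
    from Suc.IH[OF this Suc.prems(2)] False show ?thesis
      by (simp only: add_Suc runs_Suc[of "Seq c d"] nxt.simps if_False fst_conv snd_conv)
  qed
qed

lemma runs_Cond:
  "runs (if b (map read_tape ts) then c else d) ts n ts' \<Longrightarrow> runs (Cond b c d) ts (n + 1) ts'"
  by (simp add: runs_Suc act_idle)

lemma runs_Loop_done: "\<not> b (map read_tape ts) \<Longrightarrow> runs (Loop b c) ts (Suc n) ts"
  by (simp add: runs_Suc act_idle runs_Skip)

text \<open>One extra step for the test and one for passing from the finished body back to the
  loop.\<close>

lemma runs_Loop_again:
  assumes "b (map read_tape ts)" "runs c ts n ts1" "runs (Loop b c) ts1 m ts2"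
  shows "runs (Loop b c) ts (n + m + 2) ts2"
  using assms(1) runs_Seq[OF assms(2,3)] by (simp add: runs_Suc act_idle)

section \<open>Polynomially bounded functions\<close>

definition poly_bounded :: "(nat \<Rightarrow> nat) \<Rightarrow> bool" where
  "poly_bounded f \<longleftrightarrow> (\<exists>p :: nat poly. \<forall>n. f n \<le> poly p n)"

lemma poly_bounded_const: "poly_bounded (\<lambda>n. c)"
  unfolding poly_bounded_def by (rule exI[of _ "[:c:]"]) simp

lemma poly_bounded_id: "poly_bounded (\<lambda>n. n)"
  unfolding poly_bounded_def by (rule exI[of _ "[:0, 1:]"]) simp

lemma poly_bounded_add: "poly_bounded f \<Longrightarrow> poly_bounded g \<Longrightarrow> poly_bounded (\<lambda>n. f n + g n)"
  unfolding poly_bounded_def by (metis add_mono poly_add)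

lemma poly_bounded_mult: "poly_bounded f \<Longrightarrow> poly_bounded g \<Longrightarrow> poly_bounded (\<lambda>n. f n * g n)"
  unfolding poly_bounded_def by (metis mult_le_mono poly_mult)

lemmas poly_bounded_intros =
  poly_bounded_add poly_bounded_mult poly_bounded_const poly_bounded_id

section \<open>Tape heads as counters\<close>

text \<open>Symbol 4 on cell -1 is a left end marker that lets a head test its counter for 0; with
  it the machine has five symbols.\<close>

definition content :: "nat list \<Rightarrow> int \<Rightarrow> nat" where
  "content w x = (if x = -1 then 4 else if 0 \<le> x \<and> x < int (length w) then w ! nat x else 0)"

definition symbol_at :: "nat list \<Rightarrow> nat \<Rightarrow> nat" where
  "symbol_at w v = (if v = 0 then 4 else if v \<le> length w then w ! (v - 1) else 0)"

text \<open>Counter value v stands for cell v - 1, so 0 is the marker and 1 the first input symbol.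
  Values beyond the word are legitimate: the head then stands on a blank.\<close>

definition heads :: "nat \<Rightarrow> nat list \<Rightarrow> (nat \<Rightarrow> nat) \<Rightarrow> tape list" where
  "heads k w s = map (\<lambda>j. (content w, int (s j) - 1)) [0..<k]"

definition mv :: "nat \<Rightarrow> (nat \<Rightarrow> move) \<Rightarrow> com" where
  "mv k m = Act (\<lambda>ss. map (\<lambda>j. (ss ! j, m j)) [0..<k])"

definition nonzero :: "nat \<Rightarrow> nat list \<Rightarrow> bool" where
  "nonzero i ss \<longleftrightarrow> ss ! i \<noteq> 4"

text \<open>Symbols 0 and 4 are excluded so that reading 4 means counter 0, and reading 0 means a
  counter beyond the word.\<close>

definition input_word :: "nat list \<Rightarrow> bool" where
  "input_word w \<longleftrightarrow> set w \<subseteq> {1, 2, 3}"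

lemma read_heads: "i < k \<Longrightarrow> map read_tape (heads k w s) ! i = symbol_at w (s i)"
  by (auto simp: heads_def read_tape_def content_def symbol_at_def nat_diff_distrib)

lemma input_word_nth: "input_word w \<Longrightarrow> i < length w \<Longrightarrow> w ! i \<in> {1, 2, 3}"
  unfolding input_word_def using nth_mem by blast

lemma symbol_at_eq_4: "input_word w \<Longrightarrow> symbol_at w v = 4 \<longleftrightarrow> v = 0"
  using input_word_nth[of w "v - 1"] by (cases v) (auto simp: symbol_at_def)

lemma symbol_at_eq_0: "input_word w \<Longrightarrow> symbol_at w v = 0 \<longleftrightarrow> length w < v"
  using input_word_nth[of w "v - 1"] by (cases v) (auto simp: symbol_at_def)

lemma nonzero_heads: "input_word w \<Longrightarrow> i < k \<Longrightarrow> nonzero i (map read_tape (heads k w s)) \<longleftrightarrow> s i \<noteq> 0"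
  by (simp add: nonzero_def read_heads symbol_at_eq_4 del: list.map)

lemma wf_mv: "wf_com k m (mv k f)"
proof -
  have "ss ! j < m" if "length ss = k" "set ss \<subseteq> {..<m}" "j < k" for ss j
    using that nth_mem[of j ss] by blast
  then show ?thesis by (auto simp: mv_def)
qed

text \<open>The condition is stated over the integers because subtraction on \<open>nat\<close>
  truncates: it admits a left move only for a positive counter.\<close>

lemma runs_mv:
  assumes "\<And>j. j < k \<Longrightarrow> int (s' j) = int (s j) + shift (m j)" "0 < n"
  shows "runs (mv k m) (heads k w s) n (heads k w s')"
proof -
  have "runs (mv k m) (heads k w s) 1 (heads k w s')"
    unfolding mv_def using assms
    by (intro runs_Act nth_equalityI) (simp_all add: heads_def act_def read_tape_def)
  then show ?thesis by (rule runs_mono) (use assms(2) in simp)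
qed

text \<open>Giving the tapes after n rounds as an explicit family \<open>S\<close> replaces a loop
  invariant. Each round costs the body plus two steps, and the failing test costs one.\<close>

lemma runs_iterate:
  assumes "\<And>n. n < N \<Longrightarrow> b (map read_tape (S n))" "\<not> b (map read_tape (S N))"
    and body: "\<And>n. n < N \<Longrightarrow> runs c (S n) T (S (Suc n))"
  shows "runs (Loop b c) (S 0) (N * (T + 2) + 1) (S N)"
proof -
  have "runs (Loop b c) (S (N - m)) (m * (T + 2) + 1) (S N)" if "m \<le> N" for m
    using that
  proof (induction m)
    case 0
    then show ?case using assms(2) by (simp add: runs_Loop_done)
  next
    case (Suc m)
    let ?n = "N - Suc m"
    have "runs c (S ?n) T (S (N - m))" using body[of ?n] Suc.prems by (simp add: Suc_diff_Suc)
    from runs_Loop_again[OF assms(1) this Suc.IH] Suc.prems show ?case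
      by (simp add: algebra_simps)
  qed
  from this[of N] show ?thesis by simp
qed

definition rewind :: "nat \<Rightarrow> nat \<Rightarrow> com" where
  "rewind k i = Loop (nonzero i) (mv k ((\<lambda>_. Stay)(i := MoveLeft)))"

lemma runs_rewind:
  assumes "input_word w" "i < k"
  shows "runs (rewind k i) (heads k w s) (3 * s i + 1) (heads k w (s(i := 0)))"
proof -
  \<comment> \<open>Writing \<open>s i - 0\<close> exhibits the initial tapes as member 0 of the
    family with \<open>s i - n\<close> on tape i. The same device recurs in the later loops.\<close>
  have "runs (rewind k i) (heads k w (s(i := s i - 0))) (s i * (1 + 2) + 1) (heads k w (s(i := s i - s i)))"
    unfolding rewind_def
    by (rule runs_iterate) (use assms in \<open>auto simp: nonzero_heads simp del: list.map intro!: runs_mv\<close>)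
  moreover have "s i * (1 + 2) + 1 = 3 * s i + 1" by simp
  ultimately show ?thesis by (simp only: fun_upd_triv diff_zero diff_self_eq_0)
qed

text \<open>Tape 2 holds the value of tape i while it is counted down; it is empty before and after.\<close>

definition add_to :: "nat \<Rightarrow> nat \<Rightarrow> nat \<Rightarrow> com" where
  "add_to k i p = Seq
     (Loop (nonzero i) (mv k ((\<lambda>_. Stay)(i := MoveLeft, 2 := MoveRight))))
     (Loop (nonzero 2) (mv k ((\<lambda>_. Stay)(2 := MoveLeft, i := MoveRight, p := MoveRight))))"

lemma runs_add_to:
  assumes "input_word w" "4 \<le> k" "i < k" "p < k" "i \<noteq> 2" "p \<noteq> 2" "i \<noteq> p" "s 2 = 0"
  shows "runs (add_to k i p) (heads k w s) (6 * s i + 3) (heads k w (s(p := s p + s i)))"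
proof -
  let ?A = "Loop (nonzero i) (mv k ((\<lambda>_. Stay)(i := MoveLeft, 2 := MoveRight)))"
  let ?B = "Loop (nonzero 2) (mv k ((\<lambda>_. Stay)(2 := MoveLeft, i := MoveRight, p := MoveRight)))"
  have 1: "runs ?A (heads k w (s(i := s i - 0, 2 := 0))) (s i * (1 + 2) + 1)
             (heads k w (s(i := s i - s i, 2 := s i)))"
    by (rule runs_iterate) (use assms in \<open>auto simp: nonzero_heads simp del: list.map intro!: runs_mv\<close>)
  have 2: "runs ?B (heads k w (s(i := 0, 2 := s i - 0, p := s p + 0))) (s i * (1 + 2) + 1)
             (heads k w (s(i := s i, 2 := s i - s i, p := s p + s i)))"
    by (rule runs_iterate) (use assms in \<open>auto simp: nonzero_heads simp del: list.map intro!: runs_mv\<close>)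
  have eqs: "s(i := s i - 0, 2 := 0) = s" "s(i := s i - s i, 2 := s i) = s(i := 0, 2 := s i - 0, p := s p + 0)"
    "s(i := s i, 2 := s i - s i, p := s p + s i) = s(p := s p + s i)"
    using assms by auto
  have "s i * (1 + 2) + 1 + (s i * (1 + 2) + 1) + 1 = 6 * s i + 3" by simp
  with runs_Seq[OF 1[unfolded eqs] 2[unfolded eqs]] show ?thesis
    unfolding add_to_def by (simp only: eqs)
qed

text \<open>Repeated addition of \<open>u\<close> to tape 1. The number of rounds is counted on a
  copy of \<open>v\<close> on tape 3, so \<open>u\<close> and \<open>v\<close> may coincide, as they
  do for squares n * n.\<close>

definition add_product :: "nat \<Rightarrow> nat \<Rightarrow> nat \<Rightarrow> com" where
  "add_product k u v = Seq (add_to k v 3)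
     (Loop (nonzero 3) (Seq (mv k ((\<lambda>_. Stay)(3 := MoveLeft))) (add_to k u 1)))"

lemma runs_add_product:
  assumes "input_word w" "4 \<le> u" "u < k" "4 \<le> v" "v < k" "s 2 = 0" "s 3 = 0"
  shows "runs (add_product k u v) (heads k w s) (s v * (6 * s u + 7) + 6 * s v + 5)
           (heads k w (s(1 := s 1 + s u * s v)))"
proof -
  let ?B = "Seq (mv k ((\<lambda>_. Stay)(3 := MoveLeft))) (add_to k u 1)"
  define S where "S n = s(3 := s v - n, 1 := s 1 + s u * n)" for n
  have 1: "runs (add_to k v 3) (heads k w s) (6 * s v + 3) (heads k w (s(3 := s 3 + s v)))"
    using assms by (intro runs_add_to) auto
  have "runs ?B (heads k w (S n)) (1 + (6 * s u + 3) + 1) (heads k w (S (Suc n)))" if "n < s v" for n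
  proof -
    define s' where "s' = s(3 := s v - Suc n, 1 := s 1 + s u * n)"
    have "runs (mv k ((\<lambda>_. Stay)(3 := MoveLeft))) (heads k w (S n)) 1 (heads k w s')"
      using that by (intro runs_mv) (auto simp: S_def s'_def)
    moreover have "runs (add_to k u 1) (heads k w s') (6 * s' u + 3) (heads k w (s'(1 := s' 1 + s' u)))"
      using assms by (intro runs_add_to) (auto simp: s'_def)
    moreover have "s'(1 := s' 1 + s' u) = S (Suc n)" "s' u = s u"
      using assms by (auto simp: s'_def S_def)
    ultimately show ?thesis using runs_Seq by metis
  qed
  then have "runs (Loop (nonzero 3) ?B) (heads k w (S 0)) (s v * (1 + (6 * s u + 3) + 1 + 2) + 1) (heads k w (S (s v)))"
    by (intro runs_iterate) (use assms in \<open>auto simp: S_def nonzero_heads simp del: list.map fun_upd_apply\<close>, auto)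
  moreover have "S 0 = s(3 := s 3 + s v)" "S (s v) = s(1 := s 1 + s u * s v)"
    using assms by (auto simp: S_def)
  ultimately have "runs (Loop (nonzero 3) ?B) (heads k w (s(3 := s 3 + s v)))
      (s v * (6 * s u + 7) + 1) (heads k w (s(1 := s 1 + s u * s v)))"
    by (simp add: ac_simps)
  from runs_Seq[OF 1 this] show ?thesis
    unfolding add_product_def by (rule runs_mono) simp
qed

section \<open>First-order formulas with addition and multiplication\<close>

text \<open>
  The variables range over the positions of the input word, where position 0 is the left end marker
  (symbol 4).  The value of variable j is kept on tape j.  Tapes 0 to 3 hold the truth value of the
  last formula evaluated, the value of the current term, and two auxiliary counters.
\<close>

datatype monomial = One | Var nat | Prod nat nat

fun mono_val :: "(nat \<Rightarrow> nat) \<Rightarrow> monomial \<Rightarrow> nat" where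
  "mono_val s One = 1"
| "mono_val s (Var i) = s i"
| "mono_val s (Prod i j) = s i * s j"

definition term_val :: "(nat \<Rightarrow> nat) \<Rightarrow> monomial list \<Rightarrow> nat" where
  "term_val s t = sum_list (map (mono_val s) t)"

fun mono_vars :: "monomial \<Rightarrow> nat set" where
  "mono_vars One = {}"
| "mono_vars (Var i) = {i}"
| "mono_vars (Prod i j) = {i, j}"

text \<open>Terms of degree at most two suffice, because matrix entries have addresses such as n + 1
  + i * n + j. \<open>Less\<close> compares with a variable only, so a single tape has to be counted
  down and restored.\<close>

datatype fm =
    Sym "monomial list" nat
  | Less "monomial list" nat
  | Neg fm
  | And fm fm
  | Ex nat fm

fun eval :: "nat list \<Rightarrow> fm \<Rightarrow> (nat \<Rightarrow> nat) \<Rightarrow> bool" where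
  "eval w (Sym t a) s \<longleftrightarrow> symbol_at w (term_val s t) = a"
| "eval w (Less t z) s \<longleftrightarrow> term_val s t < s z"
| "eval w (Neg f) s \<longleftrightarrow> \<not> eval w f s"
| "eval w (And f g) s \<longleftrightarrow> eval w f s \<and> eval w g s"
| "eval w (Ex i f) s \<longleftrightarrow> (\<exists>a\<le>length w. eval w f (s(i := a)))"

text \<open>A quantifier reuses the tape of its variable, so rebinding a variable in scope would
  destroy its value; hence the freshness condition. Variables start at 4 because tapes 0 to 3 are
  working tapes.\<close>

fun scoped :: "nat \<Rightarrow> nat set \<Rightarrow> fm \<Rightarrow> bool" where
  "scoped k V (Sym t a) \<longleftrightarrow> \<Union> (mono_vars ` set t) \<subseteq> V"
| "scoped k V (Less t z) \<longleftrightarrow> \<Union> (mono_vars ` set t) \<subseteq> V \<and> z \<in> V"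
| "scoped k V (Neg f) \<longleftrightarrow> scoped k V f"
| "scoped k V (And f g) \<longleftrightarrow> scoped k V f \<and> scoped k V g"
| "scoped k V (Ex i f) \<longleftrightarrow> 4 \<le> i \<and> i < k \<and> i \<notin> V \<and> scoped k (insert i V) f"

lemma term_val_cong:
  assumes "\<Union> (mono_vars ` set t) \<subseteq> V" "\<And>j. j \<in> V \<Longrightarrow> s j = s' j"
  shows "term_val s t = term_val s' t"
proof -
  have "mono_val s m = mono_val s' m" if "mono_vars m \<subseteq> V" for m
    using that assms(2) by (cases m) auto
  then show ?thesis
    using assms(1) unfolding term_val_def by (intro arg_cong[of _ _ sum_list] map_cong) auto
qed

text \<open>Needed because evaluating a subformula may leave the tapes of its bound variables in new
  positions.\<close>

lemma eval_cong: "scoped k V f \<Longrightarrow> (\<And>j. j \<in> V \<Longrightarrow> s j = s' j) \<Longrightarrow> eval w f s = eval w f s'"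
proof (induction f arbitrary: V s s')
  case (Sym t a)
  then show ?case using term_val_cong[of t V s s'] by simp
next
  case (Less t z)
  then show ?case using term_val_cong[of t V s s'] by simp
next
  case (Neg f)
  then show ?case by (metis eval.simps(3) scoped.simps(3))
next
  case (And f g)
  then show ?case by (metis eval.simps(4) scoped.simps(4))
next
  case (Ex i f)
  have "eval w f (s(i := a)) = eval w f (s'(i := a))" for a
    using Ex.prems by (intro Ex.IH[of "insert i V"]) auto
  then show ?case by simp
qed

fun mono_com :: "nat \<Rightarrow> monomial \<Rightarrow> com" where
  "mono_com k One = mv k ((\<lambda>_. Stay)(1 := MoveRight))"
| "mono_com k (Var i) = add_to k i 1"
| "mono_com k (Prod i j) = add_product k i j"

fun term_com :: "nat \<Rightarrow> monomial list \<Rightarrow> com" where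
  "term_com k [] = Skip"
| "term_com k (m # t) = Seq (mono_com k m) (term_com k t)"

definition set_flag :: "nat \<Rightarrow> bool \<Rightarrow> com" where
  "set_flag k b = Seq (rewind k 0) (if b then mv k ((\<lambda>_. Stay)(0 := MoveRight)) else Skip)"

text \<open>Comparing a term with z counts both down in parallel and then restores z from tape 2.\<close>

fun fm_com :: "nat \<Rightarrow> fm \<Rightarrow> com" where
  "fm_com k (Sym t a) = Seq (term_com k t)
     (Seq (Cond (\<lambda>ss. ss ! 1 = a) (set_flag k True) (set_flag k False)) (rewind k 1))"
| "fm_com k (Less t z) = Seq (term_com k t)
     (Seq (Loop (\<lambda>ss. nonzero 1 ss \<and> nonzero z ss)
             (mv k ((\<lambda>_. Stay)(1 := MoveLeft, z := MoveLeft, 2 := MoveRight))))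
     (Seq (Cond (nonzero z) (set_flag k True) (set_flag k False))
     (Seq (Loop (nonzero 2) (mv k ((\<lambda>_. Stay)(2 := MoveLeft, z := MoveRight)))) (rewind k 1))))"
| "fm_com k (Neg f) = Seq (fm_com k f) (Cond (nonzero 0) (set_flag k False) (set_flag k True))"
| "fm_com k (And f g) = Seq (fm_com k f) (Cond (nonzero 0) (fm_com k g) Skip)"
| "fm_com k (Ex i f) = Seq (rewind k i) (Seq (set_flag k False)
     (Loop (\<lambda>ss. \<not> nonzero 0 ss \<and> ss ! i \<noteq> 0)
        (Seq (fm_com k f) (mv k ((\<lambda>_. Stay)(i := MoveRight))))))"

lemma wf_fm_com: "wf_com k m (fm_com k f)"
proof -
  have mono: "wf_com k m (mono_com k x)" for x
    by (cases x) (auto simp: wf_mv add_to_def add_product_def)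
  have "wf_com k m (term_com k t)" for t
    by (induction t) (auto simp: mono)
  then show ?thesis
    by (induction f) (auto simp: wf_mv set_flag_def rewind_def)
qed

section \<open>Correctness and running time of formula evaluation\<close>

text \<open>The uniform bound is that of the product case with both factors replaced by
  \<open>B\<close>; it dominates the other two cases.\<close>

lemma runs_mono_com:
  assumes "input_word w" "4 \<le> k" "mono_vars m \<subseteq> {4..<k}" "s 2 = 0" "s 3 = 0"
    and B: "\<And>j. 4 \<le> j \<Longrightarrow> s j \<le> B"
  shows "runs (mono_com k m) (heads k w s) (B * (6 * B + 13) + 5) (heads k w (s(1 := s 1 + mono_val s m)))"
proof (cases m)
  case One
  have "runs (mono_com k m) (heads k w s) 1 (heads k w (s(1 := s 1 + mono_val s m)))"
    unfolding One mono_com.simps by (rule runs_mv) auto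
  then show ?thesis by (rule runs_mono) simp
next
  case (Var i)
  have "runs (mono_com k m) (heads k w s) (6 * s i + 3) (heads k w (s(1 := s 1 + mono_val s m)))"
    unfolding Var mono_com.simps mono_val.simps using assms Var by (intro runs_add_to) auto
  moreover have "6 * s i \<le> 6 * B" using B[of i] assms(3) Var by auto
  ultimately show ?thesis by (elim runs_mono) (simp add: algebra_simps)
next
  case (Prod u v)
  have "runs (mono_com k m) (heads k w s) (s v * (6 * s u + 7) + 6 * s v + 5) (heads k w (s(1 := s 1 + mono_val s m)))"
    unfolding Prod mono_com.simps mono_val.simps using assms Prod by (intro runs_add_product) auto
  moreover have "s u \<le> B" "s v \<le> B" using B[of u] B[of v] assms(3) Prod by auto
  moreover have "s v * (6 * s u + 7) + 6 * s v + 5 = s v * (6 * s u + 13) + 5" by (simp add: algebra_simps)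
  ultimately show ?thesis by (elim runs_mono) (auto intro!: mult_le_mono)
qed

lemma runs_term_com:
  assumes "input_word w" "4 \<le> k" "\<Union> (mono_vars ` set t) \<subseteq> {4..<k}" "s 2 = 0" "s 3 = 0"
    and B: "\<And>j. 4 \<le> j \<Longrightarrow> s j \<le> B"
  shows "runs (term_com k t) (heads k w s) (length t * (B * (6 * B + 13) + 6))
           (heads k w (s(1 := s 1 + term_val s t)))"
  using assms(3-)
proof (induction t arbitrary: s)
  case Nil
  then show ?case by (simp add: term_val_def runs_Skip)
next
  case (Cons m t)
  let ?s = "s(1 := s 1 + mono_val s m)"
  have 1: "runs (mono_com k m) (heads k w s) (B * (6 * B + 13) + 5) (heads k w ?s)"
    using Cons.prems assms(1,2) by (intro runs_mono_com) auto
  have "runs (term_com k t) (heads k w ?s) (length t * (B * (6 * B + 13) + 6)) (heads k w (?s(1 := ?s 1 + term_val ?s t)))"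
    using Cons.prems by (intro Cons.IH) auto
  moreover have "term_val ?s t = term_val s t"
    using Cons.prems by (intro term_val_cong[of t "{4..<k}"]) auto
  then have "?s(1 := ?s 1 + term_val ?s t) = s(1 := s 1 + term_val s (m # t))"
    by (simp add: term_val_def add.assoc)
  ultimately have "runs (term_com k t) (heads k w ?s) (length t * (B * (6 * B + 13) + 6))
      (heads k w (s(1 := s 1 + term_val s (m # t))))" by simp
  from runs_Seq[OF 1 this] show ?case unfolding term_com.simps by (rule runs_mono) simp
qed

text \<open>Rewinding tape 1 takes time proportional to the value of the term. The square of B + 1
  covers all three kinds of monomials, including \<open>One\<close> when B = 0.\<close>

lemma term_val_le:
  assumes "\<Union> (mono_vars ` set t) \<subseteq> {4..<k}" "\<And>j. 4 \<le> j \<Longrightarrow> s j \<le> B"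
  shows "term_val s t \<le> length t * ((B + 1) * (B + 1))"
proof -
  have "mono_val s m \<le> (B + 1) * (B + 1)" if "mono_vars m \<subseteq> {4..<k}" for m
  proof (cases m)
    case (Var i)
    then have "s i \<le> B" using that assms(2) by simp
    then show ?thesis using Var by simp
  next
    case (Prod i j)
    then have "s i \<le> B" "s j \<le> B" using that assms(2) by simp_all
    then show ?thesis using Prod by (auto intro: mult_le_mono simp del: mult_Suc_right mult_Suc)
  qed simp
  then show ?thesis
    using assms(1) unfolding term_val_def
  proof (induction t)
    case (Cons m t)
    then have "mono_val s m + sum_list (map (mono_val s) t) \<le>
        (B + 1) * (B + 1) + length t * ((B + 1) * (B + 1))"
      by (intro add_le_mono) auto
    then show ?case by simp
  qed simp
qed

lemma runs_set_flag:
  assumes "input_word w" "0 < k" "s 0 \<le> 1"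
  shows "runs (set_flag k b) (heads k w s) 6 (heads k w (s(0 := of_bool b)))"
proof -
  have 1: "runs (rewind k 0) (heads k w s) 4 (heads k w (s(0 := 0)))"
    using runs_mono[OF runs_rewind[of w 0 k s], of 4] assms by auto
  have "runs (if b then mv k ((\<lambda>_. Stay)(0 := MoveRight)) else Skip) (heads k w (s(0 := 0))) 1
          (heads k w (s(0 := of_bool b)))"
    by (auto intro!: runs_mv runs_Skip)
  from runs_Seq[OF 1 this] show ?thesis by (simp add: set_flag_def)
qed

lemma runs_Cond_flag:
  assumes "input_word w" "0 < k" "s 0 \<le> 1"
  shows "runs (Cond c (set_flag k True) (set_flag k False)) (heads k w s) 7
    (heads k w (s(0 := of_bool (c (map read_tape (heads k w s))))))"
    "runs (Cond c (set_flag k False) (set_flag k True)) (heads k w s) 7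
    (heads k w (s(0 := of_bool (\<not> c (map read_tape (heads k w s))))))"
proof -
  have if1: "(if x then set_flag k True else set_flag k False) = set_flag k x"
   and if2: "(if x then set_flag k False else set_flag k True) = set_flag k (\<not> x)" for x by auto
  have "6 + 1 = (7::nat)" by simp
  then show "runs (Cond c (set_flag k True) (set_flag k False)) (heads k w s) 7
    (heads k w (s(0 := of_bool (c (map read_tape (heads k w s))))))"
    "runs (Cond c (set_flag k False) (set_flag k True)) (heads k w s) 7
    (heads k w (s(0 := of_bool (\<not> c (map read_tape (heads k w s))))))"
    using runs_Cond[of c "heads k w s" "set_flag k True" "set_flag k False" 6, unfolded if1]
      runs_Cond[of c "heads k w s" "set_flag k False" "set_flag k True" 6, unfolded if2]
      runs_set_flag[where s = s and k = k and w = w, OF assms]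
    by simp_all
qed

text \<open>An unsuccessful search leaves its variable one past the last position, hence the bound Suc N.\<close>

definition normal :: "nat \<Rightarrow> (nat \<Rightarrow> nat) \<Rightarrow> bool" where
  "normal N s \<longleftrightarrow> s 0 \<le> 1 \<and> s 1 = 0 \<and> s 2 = 0 \<and> s 3 = 0 \<and> (\<forall>j\<ge>4. s j \<le> Suc N)"

lemma runs_fm_Sym:
  assumes "input_word w" "4 \<le> k" "\<Union> (mono_vars ` set t) \<subseteq> {4..<k}" "normal N s"
  shows "runs (fm_com k (Sym t a)) (heads k w s)
      (length t * (Suc N * (6 * Suc N + 13) + 6) + 3 * (length t * ((Suc N + 1) * (Suc N + 1))) + 10)
      (heads k w (s(0 := of_bool (eval w (Sym t a) s))))"
proof -
  define v where "v = term_val s t"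
  define s1 where "s1 = s(1 := v)"
  define s2 where "s2 = s1(0 := of_bool (symbol_at w v = a))"
  have v: "v \<le> length t * ((Suc N + 1) * (Suc N + 1))"
    unfolding v_def using assms by (intro term_val_le) (auto simp: normal_def)
  have 1: "runs (term_com k t) (heads k w s) (length t * (Suc N * (6 * Suc N + 13) + 6)) (heads k w s1)"
    using runs_term_com[of w k t s "Suc N"] assms by (simp add: normal_def s1_def v_def)
  have s1: "s1 0 \<le> 1" "s1 1 = v" using assms by (auto simp: s1_def normal_def)
  have 2: "runs (Cond (\<lambda>ss. ss ! 1 = a) (set_flag k True) (set_flag k False)) (heads k w s1) 7 (heads k w s2)"
    using runs_Cond_flag(1)[of w k s1 "\<lambda>ss. ss ! 1 = a"] assms(1,2) s1
    by (simp add: read_heads s2_def del: list.map)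
  have "s2(1 := 0) = s(0 := of_bool (eval w (Sym t a) s))" "s2 1 = v"
    using assms by (auto simp: normal_def s2_def s1_def v_def)
  then have 3: "runs (rewind k 1) (heads k w s2) (3 * v + 1) (heads k w (s(0 := of_bool (eval w (Sym t a) s))))"
    using runs_rewind[of w 1 k s2] assms by simp
  from runs_Seq[OF 1 runs_Seq[OF 2 3]] show ?thesis
    unfolding fm_com.simps by (rule runs_mono) (use v in simp)
qed

lemma runs_fm_Less:
  assumes "input_word w" "4 \<le> k" "\<Union> (mono_vars ` set t) \<subseteq> {4..<k}" "z \<in> {4..<k}" "normal N s"
  shows "runs (fm_com k (Less t z)) (heads k w s)
      (length t * (Suc N * (6 * Suc N + 13) + 6) + 3 * (length t * ((Suc N + 1) * (Suc N + 1))) + 6 * Suc N + 20)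
      (heads k w (s(0 := of_bool (eval w (Less t z) s))))"
proof -
  define v where "v = term_val s t"
  \<comment> \<open>The number of rounds of the parallel countdown. Afterwards tape z is nonzero iff
    v < s z, and tape 2 holds exactly what z has lost.\<close>
  define d where "d = min v (s z)"
  define s1 where "s1 = s(1 := v)"
  define s2 where "s2 = s(1 := v - d, z := s z - d, 2 := d)"
  define s3 where "s3 = s2(0 := of_bool (v < s z))"
  define s4 where "s4 = s(1 := v - d, 0 := of_bool (v < s z))"
  have v: "v \<le> length t * ((Suc N + 1) * (Suc N + 1))"
    unfolding v_def using assms by (intro term_val_le) (auto simp: normal_def)
  have z: "s z \<le> Suc N" using assms by (simp add: normal_def)
  have 1: "runs (term_com k t) (heads k w s) (length t * (Suc N * (6 * Suc N + 13) + 6)) (heads k w s1)"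
    using runs_term_com[of w k t s "Suc N"] assms by (simp add: normal_def s1_def v_def)
  have "runs (Loop (\<lambda>ss. nonzero 1 ss \<and> nonzero z ss)
             (mv k ((\<lambda>_. Stay)(1 := MoveLeft, z := MoveLeft, 2 := MoveRight))))
     (heads k w (s(1 := v - 0, z := s z - 0, 2 := 0))) (d * (1 + 2) + 1) (heads k w s2)"
    unfolding s2_def
    by (rule runs_iterate)
       (use assms in \<open>auto simp: nonzero_heads d_def simp del: list.map intro!: runs_mv\<close>)
  moreover have "s(1 := v - 0, z := s z - 0, 2 := 0) = s1"
    using assms by (auto simp: normal_def s1_def)
  ultimately have 2: "runs (Loop (\<lambda>ss. nonzero 1 ss \<and> nonzero z ss)
             (mv k ((\<lambda>_. Stay)(1 := MoveLeft, z := MoveLeft, 2 := MoveRight))))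
     (heads k w s1) (d * (1 + 2) + 1) (heads k w s2)" by simp
  have s2: "s2 0 \<le> 1" "s2 z \<noteq> 0 \<longleftrightarrow> v < s z" using assms by (auto simp: s2_def normal_def d_def)
  have 3: "runs (Cond (nonzero z) (set_flag k True) (set_flag k False)) (heads k w s2) 7 (heads k w s3)"
    using runs_Cond_flag(1)[of w k s2 "nonzero z"] assms s2
    by (simp add: nonzero_heads s3_def del: list.map)
  have "runs (Loop (nonzero 2) (mv k ((\<lambda>_. Stay)(2 := MoveLeft, z := MoveRight))))
     (heads k w (s4(2 := d - 0, z := s z - d + 0))) (d * (1 + 2) + 1) (heads k w (s4(2 := d - d, z := s z - d + d)))"
    by (rule runs_iterate)
       (use assms in \<open>auto simp: nonzero_heads simp del: list.map intro!: runs_mv\<close>)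
  moreover have "s4(2 := d - 0, z := s z - d + 0) = s3" "s4(2 := d - d, z := s z - d + d) = s4"
    using assms by (auto simp: normal_def s3_def s4_def s2_def d_def)
  ultimately have 4: "runs (Loop (nonzero 2) (mv k ((\<lambda>_. Stay)(2 := MoveLeft, z := MoveRight))))
     (heads k w s3) (d * (1 + 2) + 1) (heads k w s4)" by simp
  have "s4(1 := 0) = s(0 := of_bool (eval w (Less t z) s))" "s4 1 = v - d"
    using assms by (auto simp: normal_def s4_def v_def)
  then have 5: "runs (rewind k 1) (heads k w s4) (3 * (v - d) + 1) (heads k w (s(0 := of_bool (eval w (Less t z) s))))"
    using runs_rewind[of w 1 k s4] assms by simp
  have "d \<le> s z" "d \<le> v" by (simp_all add: d_def)
  from runs_Seq[OF 1 runs_Seq[OF 2 runs_Seq[OF 3 runs_Seq[OF 4 5]]]] show ?thesis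
    unfolding fm_com.simps by (rule runs_mono) (use v z \<open>d \<le> s z\<close> \<open>d \<le> v\<close> in simp)
qed

text \<open>The contract for the induction over formulas. The final counters are existential because
  only those in \<open>V\<close> are preserved; \<open>normal\<close> holds again afterwards, so
  evaluations can be chained. The time depends on the length of the word only.\<close>

definition computes :: "nat \<Rightarrow> nat set \<Rightarrow> fm \<Rightarrow> (nat \<Rightarrow> nat) \<Rightarrow> bool" where
  "computes k V f T \<longleftrightarrow> (\<forall>w s. input_word w \<and> normal (length w) s \<longrightarrow>
     (\<exists>s'. runs (fm_com k f) (heads k w s) (T (length w)) (heads k w s') \<and>
           normal (length w) s' \<and> (\<forall>j\<in>V. s' j = s j) \<and> s' 0 = of_bool (eval w f s)))"

lemma computesE:
  assumes "computes k V f T" "input_word w" "normal (length w) s"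
  obtains s' where "runs (fm_com k f) (heads k w s) (T (length w)) (heads k w s')"
    "normal (length w) s'" "\<And>j. j \<in> V \<Longrightarrow> s' j = s j" "s' 0 = of_bool (eval w f s)"
  using assms unfolding computes_def by blast

text \<open>Induction on the number m of candidates left. The contract for \<open>f\<close> includes
  i among the preserved variables, so the search position survives each evaluation of the body. The
  result concerns candidates from the current one on, which is what makes the induction go
  through.\<close>

lemma runs_fm_Ex:
  assumes c: "computes k (insert i V) f T" and i: "4 \<le> i" "i < k" "i \<notin> V" "scoped k (insert i V) f"
    and V: "V \<subseteq> {4..<k}"
    and w: "input_word w"
  shows "normal (length w) s \<Longrightarrow> s 0 = 0 \<Longrightarrow> s i + m = Suc (length w) \<Longrightarrow>
    \<exists>s'. runs (Loop (\<lambda>ss. \<not> nonzero 0 ss \<and> ss ! i \<noteq> 0)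
                 (Seq (fm_com k f) (mv k ((\<lambda>_. Stay)(i := MoveRight)))))
            (heads k w s) (m * (T (length w) + 4) + 1) (heads k w s') \<and>
       normal (length w) s' \<and> (\<forall>j\<in>V. s' j = s j) \<and>
       s' 0 = of_bool (\<exists>a. s i \<le> a \<and> a \<le> length w \<and> eval w f (s(i := a)))"
proof (induction m arbitrary: s)
  case 0
  \<comment> \<open>No candidate is left: tape i has reached the blank behind the word, which ends
    the loop with the flag still 0.\<close>
  have "symbol_at w (s i) = 0" using 0 by (simp add: symbol_at_def)
  then have "map read_tape (heads k w s) ! i = 0" using i by (simp only: read_heads)
  then have "runs (Loop (\<lambda>ss. \<not> nonzero 0 ss \<and> ss ! i \<noteq> 0)
      (Seq (fm_com k f) (mv k ((\<lambda>_. Stay)(i := MoveRight))))) (heads k w s) (Suc 0) (heads k w s)"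
    by (intro runs_Loop_done) simp
  then show ?case using 0 by (intro exI[of _ s]) (simp del: fun_upd_apply)
next
  case (Suc m)
  let ?b = "\<lambda>ss. \<not> nonzero 0 ss \<and> ss ! i \<noteq> 0"
  let ?c = "Seq (fm_com k f) (mv k ((\<lambda>_. Stay)(i := MoveRight)))"
  from c w Suc.prems(1) obtain s1 where s1: "runs (fm_com k f) (heads k w s) (T (length w)) (heads k w s1)"
    "normal (length w) s1" "\<And>j. j \<in> insert i V \<Longrightarrow> s1 j = s j" "s1 0 = of_bool (eval w f s)"
    by (rule computesE) blast
  define s2 where "s2 = s1(i := Suc (s i))"
  have s2: "normal (length w) s2" "s2 0 = of_bool (eval w f s)" "\<And>j. j \<in> V \<Longrightarrow> s2 j = s j" "s2 i = Suc (s i)"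
    using s1(2,3,4) i Suc.prems by (auto simp: s2_def normal_def)
  have "runs (mv k ((\<lambda>_. Stay)(i := MoveRight))) (heads k w s1) 1 (heads k w s2)"
    using s1(3)[of i] by (intro runs_mv) (auto simp: s2_def)
  from runs_Seq[OF s1(1) this]
  have body: "runs ?c (heads k w s) (T (length w) + 2) (heads k w s2)" by simp
  have b: "?b (map read_tape (heads k w s))"
    using Suc.prems w i by (auto simp: nonzero_heads read_heads symbol_at_eq_0 simp del: list.map)
  have split: "(\<exists>a. s i \<le> a \<and> a \<le> length w \<and> eval w f (s(i := a))) \<longleftrightarrow>
      eval w f s \<or> (\<exists>a. Suc (s i) \<le> a \<and> a \<le> length w \<and> eval w f (s(i := a)))"
  proof -
    have "s i \<le> length w" using Suc.prems(3) by simp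
    then have "{a. s i \<le> a \<and> a \<le> length w} = insert (s i) {a. Suc (s i) \<le> a \<and> a \<le> length w}"
      by auto
    then have "(\<exists>a\<in>{a. s i \<le> a \<and> a \<le> length w}. eval w f (s(i := a))) \<longleftrightarrow>
      eval w f s \<or> (\<exists>a\<in>{a. Suc (s i) \<le> a \<and> a \<le> length w}. eval w f (s(i := a)))"
      by (simp only: bex_simps fun_upd_triv)
    then show ?thesis by blast
  qed
  show ?case
  proof (cases "eval w f s")
    case True
    then have "s2 0 = 1" using s2 by simp
    then have "runs (Loop ?b ?c) (heads k w s2) (Suc 0) (heads k w s2)"
      using w i by (intro runs_Loop_done) (simp add: nonzero_heads del: list.map)
    from runs_Loop_again[where b = ?b, OF b body this]
    have "runs (Loop ?b ?c) (heads k w s) (Suc m * (T (length w) + 4) + 1) (heads k w s2)"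
      by (rule runs_mono) simp
    then show ?thesis using s2(1,2,3) True split
      by (intro exI[of _ s2] conjI ballI) (simp_all only: of_bool_eq simp_thms)
  next
    case False
    have "eval w f (s2(i := a)) = eval w f (s(i := a))" for a
      using i(4) by (rule eval_cong) (use s2(3) in auto)
    then have eq: "(\<exists>a. s2 i \<le> a \<and> a \<le> length w \<and> eval w f (s2(i := a))) \<longleftrightarrow>
       (\<exists>a. s i \<le> a \<and> a \<le> length w \<and> eval w f (s(i := a)))"
      using split False s2(4) by simp
    obtain s' where s': "runs (Loop ?b ?c) (heads k w s2) (m * (T (length w) + 4) + 1) (heads k w s')"
       "normal (length w) s'" "\<forall>j\<in>V. s' j = s2 j"
       "s' 0 = of_bool (\<exists>a. s2 i \<le> a \<and> a \<le> length w \<and> eval w f (s2(i := a)))"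
      using Suc.IH[OF s2(1)] s2(2,4) False Suc.prems(3) by fastforce
    from runs_Loop_again[where b = ?b, OF b body s'(1)]
    have "runs (Loop ?b ?c) (heads k w s) (Suc m * (T (length w) + 4) + 1) (heads k w s')"
      by (rule runs_mono) simp
    then show ?thesis using s'(2,3,4) s2(3) eq by (intro exI[of _ s'] conjI ballI) (simp_all del: fun_upd_apply)
  qed
qed

lemma normal_flag: "normal N s \<Longrightarrow> normal N (s(0 := of_bool b))"
  by (auto simp: normal_def)

text \<open>A quantifier multiplies the time bound by about N + 1, and the other connectives add.
  The degree of the polynomial thus depends on the formula only.\<close>

theorem fm_com_polytime:
  assumes "scoped k V f" "V \<subseteq> {4..<k}" "4 \<le> k"
  shows "\<exists>T. poly_bounded T \<and> computes k V f T"
  using assms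
proof (induction f arbitrary: V)
  case (Sym t a)
  let ?T = "\<lambda>N. length t * ((N + 1) * (6 * (N + 1) + 13) + 6) + 3 * (length t * ((N + 2) * (N + 2))) + 10"
  have "poly_bounded ?T" by (intro poly_bounded_intros)
  moreover have "computes k V (Sym t a) ?T"
    unfolding computes_def
  proof (intro allI impI)
    fix w s assume *: "input_word w \<and> normal (length w) s"
    then show "\<exists>s'. runs (fm_com k (Sym t a)) (heads k w s) (?T (length w)) (heads k w s') \<and>
           normal (length w) s' \<and> (\<forall>j\<in>V. s' j = s j) \<and> s' 0 = of_bool (eval w (Sym t a) s)"
      using runs_fm_Sym[of w k t "length w" s a] Sym.prems normal_flag
      by (intro exI[of _ "s(0 := of_bool (eval w (Sym t a) s))"])
         (auto simp del: eval.simps fm_com.simps simp: algebra_simps)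
  qed
  ultimately show ?case by blast
next
  case (Less t z)
  let ?T = "\<lambda>N. length t * ((N + 1) * (6 * (N + 1) + 13) + 6) + 3 * (length t * ((N + 2) * (N + 2))) + 6 * (N + 1) + 20"
  have "poly_bounded ?T" by (intro poly_bounded_intros)
  moreover have "computes k V (Less t z) ?T"
    unfolding computes_def
  proof (intro allI impI)
    fix w s assume *: "input_word w \<and> normal (length w) s"
    have "\<Union> (mono_vars ` set t) \<subseteq> {4..<k}" "z \<in> {4..<k}" using Less.prems by auto
    with * show "\<exists>s'. runs (fm_com k (Less t z)) (heads k w s) (?T (length w)) (heads k w s') \<and>
           normal (length w) s' \<and> (\<forall>j\<in>V. s' j = s j) \<and> s' 0 = of_bool (eval w (Less t z) s)"
      using runs_fm_Less[of w k t z "length w" s] Less.prems(2,3) normal_flag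
      by (intro exI[of _ "s(0 := of_bool (eval w (Less t z) s))"])
         (auto simp del: eval.simps fm_com.simps simp: algebra_simps)
  qed
  ultimately show ?case by blast
next
  case (Neg f)
  have "scoped k V f" using Neg.prems(1) by simp
  then obtain T where T: "poly_bounded T" "computes k V f T"
    using Neg.IH[OF _ Neg.prems(2,3)] by blast
  have "poly_bounded (\<lambda>N. T N + 8)" using T(1) by (intro poly_bounded_intros)
  moreover have "computes k V (Neg f) (\<lambda>N. T N + 8)"
    unfolding computes_def
  proof (intro allI impI)
    fix w s assume *: "input_word w \<and> normal (length w) s"
    then obtain s1 where s1: "runs (fm_com k f) (heads k w s) (T (length w)) (heads k w s1)"
      "normal (length w) s1" "\<And>j. j \<in> V \<Longrightarrow> s1 j = s j" "s1 0 = of_bool (eval w f s)"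
      using computesE[OF T(2)] by metis
    have "runs (Cond (nonzero 0) (set_flag k False) (set_flag k True)) (heads k w s1) 7
       (heads k w (s1(0 := of_bool (\<not> nonzero 0 (map read_tape (heads k w s1))))))"
      using * Neg.prems s1(2) by (intro runs_Cond_flag(2)) (auto simp: normal_def)
    moreover have "nonzero 0 (map read_tape (heads k w s1)) \<longleftrightarrow> eval w f s"
      using * Neg.prems s1(4) by (simp add: nonzero_heads del: list.map)
    ultimately have "runs (Cond (nonzero 0) (set_flag k False) (set_flag k True)) (heads k w s1) 7
       (heads k w (s1(0 := of_bool (eval w (Neg f) s))))" by simp
    from runs_Seq[OF s1(1) this]
    have "runs (fm_com k (Neg f)) (heads k w s) (T (length w) + 8)
       (heads k w (s1(0 := of_bool (eval w (Neg f) s))))"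
      unfolding fm_com.simps by (rule runs_mono) simp
    then show "\<exists>s'. runs (fm_com k (Neg f)) (heads k w s) (T (length w) + 8) (heads k w s') \<and>
           normal (length w) s' \<and> (\<forall>j\<in>V. s' j = s j) \<and> s' 0 = of_bool (eval w (Neg f) s)"
      using s1(2,3) Neg.prems normal_flag[OF s1(2)]
      by (intro exI[of _ "s1(0 := of_bool (eval w (Neg f) s))"])
         (auto simp del: fm_com.simps eval.simps)
  qed
  ultimately show ?case by blast
next
  case (And f g)
  have fg: "scoped k V f" "scoped k V g" using And.prems(1) by simp_all
  obtain T where T: "poly_bounded T" "computes k V f T"
    using And.IH(1)[OF fg(1) And.prems(2,3)] by blast
  obtain U where U: "poly_bounded U" "computes k V g U"
    using And.IH(2)[OF fg(2) And.prems(2,3)] by blast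
  have "poly_bounded (\<lambda>N. T N + U N + 2)" using T(1) U(1) by (intro poly_bounded_intros)
  moreover have "computes k V (And f g) (\<lambda>N. T N + U N + 2)"
    unfolding computes_def
  proof (intro allI impI)
    fix w s assume *: "input_word w \<and> normal (length w) s"
    then obtain s1 where s1: "runs (fm_com k f) (heads k w s) (T (length w)) (heads k w s1)"
      "normal (length w) s1" "\<And>j. j \<in> V \<Longrightarrow> s1 j = s j" "s1 0 = of_bool (eval w f s)"
      using computesE[OF T(2)] by metis
    obtain s2 where s2: "runs (fm_com k g) (heads k w s1) (U (length w)) (heads k w s2)"
      "normal (length w) s2" "\<And>j. j \<in> V \<Longrightarrow> s2 j = s1 j" "s2 0 = of_bool (eval w g s1)"
      using computesE[OF U(2)] * s1(2) by metis
    have g: "eval w g s1 = eval w g s" using fg(2) s1(3) by (rule eval_cong)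
    define s' where "s' = (if eval w f s then s2 else s1)"
    have n: "nonzero 0 (map read_tape (heads k w s1)) \<longleftrightarrow> eval w f s"
      using * And.prems s1(4) by (simp add: nonzero_heads del: list.map)
    have "runs (if nonzero 0 (map read_tape (heads k w s1)) then fm_com k g else Skip) (heads k w s1)
        (U (length w)) (heads k w s')"
      unfolding n using s2(1) by (auto simp: s'_def runs_Skip)
    from runs_Seq[OF s1(1) runs_Cond[where b = "nonzero 0" and c = "fm_com k g" and d = Skip, OF this]]
    have "runs (fm_com k (And f g)) (heads k w s) (T (length w) + U (length w) + 2) (heads k w s')" by simp
    then show "\<exists>s'. runs (fm_com k (And f g)) (heads k w s) (T (length w) + U (length w) + 2) (heads k w s') \<and>
           normal (length w) s' \<and> (\<forall>j\<in>V. s' j = s j) \<and> s' 0 = of_bool (eval w (And f g) s)"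
      using s1(2-4) s2(2-4) g
      by (intro exI[of _ s'] conjI ballI) (simp_all add: s'_def del: fm_com.simps)
  qed
  ultimately show ?case by blast
next
  case (Ex i f)
  have i: "4 \<le> i" "i < k" "i \<notin> V" "scoped k (insert i V) f" using Ex.prems by auto
  then have "insert i V \<subseteq> {4..<k}" using Ex.prems(2) by simp
  then obtain T where T: "poly_bounded T" "computes k (insert i V) f T"
    using Ex.IH[OF i(4) _ Ex.prems(3)] by blast
  let ?T = "\<lambda>N. 3 * (N + 1) + (N + 1) * (T N + 4) + 10"
  have "poly_bounded ?T" using T(1) by (intro poly_bounded_intros)
  moreover have "computes k V (Ex i f) ?T"
    unfolding computes_def
  proof (intro allI impI)
    fix w s assume *: "input_word w \<and> normal (length w) s"
    define s1 where "s1 = s(i := 0)"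
    define s2 where "s2 = s1(0 := of_bool False)"
    have s1: "s1 0 \<le> 1" and s2: "normal (length w) s2" "s2 0 = 0" "s2 i = 0"
      and V: "\<And>j. j \<in> V \<Longrightarrow> s2 j = s j"
      using * Ex.prems i by (auto simp: s2_def s1_def normal_def)
    have 1: "runs (rewind k i) (heads k w s) (3 * s i + 1) (heads k w s1)"
      unfolding s1_def using * i by (intro runs_rewind) auto
    have 2: "runs (set_flag k False) (heads k w s1) 6 (heads k w s2)"
      unfolding s2_def using * s1 i by (intro runs_set_flag) auto
    obtain s' where s': "runs (Loop (\<lambda>ss. \<not> nonzero 0 ss \<and> ss ! i \<noteq> 0)
                 (Seq (fm_com k f) (mv k ((\<lambda>_. Stay)(i := MoveRight)))))
            (heads k w s2) (Suc (length w) * (T (length w) + 4) + 1) (heads k w s')"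
       "normal (length w) s'" "\<forall>j\<in>V. s' j = s2 j"
       "s' 0 = of_bool (\<exists>a. s2 i \<le> a \<and> a \<le> length w \<and> eval w f (s2(i := a)))"
      using runs_fm_Ex[OF T(2) i Ex.prems(2), of w s2 "Suc (length w)"] * s2 by auto
    have "eval w f (s2(i := a)) = eval w f (s(i := a))" for a
      using i(4) by (rule eval_cong) (use V in auto)
    then have "s' 0 = of_bool (eval w (Ex i f) s)" using s'(4) s2(3) by simp
    \<comment> \<open>Tape i may still stand where an earlier search stopped, at most one past the
      end; this bounds the cost of the initial rewinding.\<close>
    moreover have "s i \<le> length w + 1" using * i by (simp add: normal_def)
    then have "runs (fm_com k (Ex i f)) (heads k w s) (?T (length w)) (heads k w s')"
      using runs_Seq[OF 1 runs_Seq[OF 2 s'(1)]] unfolding fm_com.simps by (elim runs_mono) simp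
    ultimately show "\<exists>s'. runs (fm_com k (Ex i f)) (heads k w s) (?T (length w)) (heads k w s') \<and>
           normal (length w) s' \<and> (\<forall>j\<in>V. s' j = s j) \<and> s' 0 = of_bool (eval w (Ex i f) s)"
      using s'(2,3) V by (intro exI[of _ s'] conjI ballI) (simp_all del: fm_com.simps eval.simps)
  qed
  ultimately show ?case by blast
qed

section \<open>Predicates defined by formulas are decidable in polynomial time\<close>

text \<open>Establishes the invariant of \<open>heads\<close>: every tape receives the left marker,
  then tape 0 is copied onto all tapes up to the first blank, and all heads return to the marker
  together.\<close>

definition init_com :: "nat \<Rightarrow> com" where
  "init_com k = Seq (mv k (\<lambda>_. MoveLeft)) (Seq (Act (\<lambda>ss. map (\<lambda>j. (4, MoveRight)) [0..<k]))
     (Seq (Loop (\<lambda>ss. ss ! 0 \<noteq> 0) (Act (\<lambda>ss. map (\<lambda>j. (ss ! 0, MoveRight)) [0..<k])))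
          (Loop (nonzero 0) (mv k (\<lambda>_. MoveLeft)))))"

lemma wf_init_com: "0 < k \<Longrightarrow> wf_com k 5 (init_com k)"
proof -
  assume "0 < k"
  then have "ss ! 0 < 5" if "length ss = k" "set ss \<subseteq> {..<5}" for ss :: "nat list"
    using that nth_mem[of 0 ss] by blast
  then show ?thesis by (auto simp: init_com_def wf_mv)
qed

text \<open>The tapes during initialization: m is the symbol on cell -1, n the number of cells
  already copied, h the common head position. With all three equal to 0 this is the start
  configuration.\<close>

definition partial_copy :: "nat \<Rightarrow> nat list \<Rightarrow> nat \<Rightarrow> nat \<Rightarrow> int \<Rightarrow> tape list" where
  "partial_copy k w m n h = map (\<lambda>j. (\<lambda>x. if x = -1 then m
      else if 0 \<le> x \<and> x < int (if j = 0 then length w else n) then w ! nat x else 0, h)) [0..<k]"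

lemma runs_init_com:
  assumes "input_word w" "0 < k"
  shows "runs (init_com k) (partial_copy k w 0 0 0) (7 * length w + 10) (heads k w (\<lambda>_. 0))"
proof -
  have 1: "runs (mv k (\<lambda>_. MoveLeft)) (partial_copy k w 0 0 0) 1 (partial_copy k w 0 0 (-1))"
    unfolding mv_def
    by (intro runs_Act nth_equalityI) (auto simp: partial_copy_def act_def read_tape_def)
  have 2: "runs (Act (\<lambda>ss. map (\<lambda>j. (4, MoveRight)) [0..<k])) (partial_copy k w 0 0 (-1)) 1
      (partial_copy k w 4 0 (int 0))"
    by (intro runs_Act nth_equalityI) (auto simp: partial_copy_def act_def)
  have rd: "map read_tape (partial_copy k w 4 n (int m)) ! 0 = (if m < length w then w ! m else 0)" for n m
    using assms by (simp add: partial_copy_def read_tape_def)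
  have 3: "runs (Loop (\<lambda>ss. ss ! 0 \<noteq> 0) (Act (\<lambda>ss. map (\<lambda>j. (ss ! 0, MoveRight)) [0..<k])))
     (partial_copy k w 4 0 (int 0)) (length w * (1 + 2) + 1) (partial_copy k w 4 (length w) (int (length w)))"
  proof (rule runs_iterate)
    fix n assume n: "n < length w"
    show "map read_tape (partial_copy k w 4 n (int n)) ! 0 \<noteq> 0"
      using n input_word_nth[OF assms(1) n] by (auto simp: rd simp del: list.map)
    show "runs (Act (\<lambda>ss. map (\<lambda>j. (ss ! 0, MoveRight)) [0..<k])) (partial_copy k w 4 n (int n)) 1
        (partial_copy k w 4 (Suc n) (int (Suc n)))"
      using n by (intro runs_Act nth_equalityI)
        (auto simp: rd partial_copy_def act_def fun_eq_iff read_tape_def less_Suc_eq_le)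
  qed (simp add: rd del: list.map)
  \<comment> \<open>The heads are now on the first blank, which is counter value
    \<open>Suc (length w)\<close>.\<close>
  have copied: "partial_copy k w 4 (length w) (int (length w)) = heads k w (\<lambda>_. Suc (length w) - 0)"
    by (simp add: partial_copy_def heads_def content_def fun_eq_iff)
  have 4: "runs (Loop (nonzero 0) (mv k (\<lambda>_. MoveLeft))) (heads k w (\<lambda>_. Suc (length w) - 0))
     (Suc (length w) * (1 + 2) + 1) (heads k w (\<lambda>_. Suc (length w) - Suc (length w)))"
    by (rule runs_iterate)
       (use assms in \<open>auto simp: nonzero_heads simp del: list.map intro!: runs_mv\<close>)
  from runs_Seq[OF 1 runs_Seq[OF 2 runs_Seq[OF 3[unfolded copied] 4]]] show ?thesis
    unfolding init_com_def by simp (erule runs_mono, simp)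
qed

lemma tapes_start: "0 < tapes M \<Longrightarrow> snd (start M w) = partial_copy (tapes M) w 0 0 0"
  by (intro nth_equalityI) (auto simp: start_def partial_copy_def nth_Cons fun_eq_iff split: nat.splits)

theorem polytime_decidable_fm:
  assumes "scoped k {} f" "4 \<le> k"
  shows "polytime_decidable (\<lambda>x y. eval (pair_input x y) f (\<lambda>_. 0))"
proof -
  obtain T where T: "poly_bounded T" "computes k {} f T"
    using fm_com_polytime[OF assms(1)] assms(2) by auto
  have "wf_com k 5 (Seq (init_com k) (fm_com k f))"
    using wf_init_com wf_fm_com assms(2) by simp
  then obtain M where M: "wf_machine M" "tapes M = k"
    "\<And>w n ts'. runs (Seq (init_com k) (fm_com k f)) (snd (start M w)) n ts' \<Longrightarrow>
       decides_within M w (nonzero 0 (map read_tape ts')) (n + 2)"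
    by (rule com_machine[where b = "nonzero 0"]) (use assms(2) in auto)
  \<comment> \<open>The summand 3 consists of one step for the sequencing and the two steps added by
    \<open>com_machine\<close>.\<close>
  have "poly_bounded (\<lambda>N. 7 * N + 10 + T N + 3)" using T(1) by (intro poly_bounded_intros)
  then obtain p :: "nat poly" where p: "\<And>N. 7 * N + 10 + T N + 3 \<le> poly p N"
    unfolding poly_bounded_def by blast
  have "decides_within M w (eval w f (\<lambda>_. 0)) (poly p (length w))" if w: "input_word w" for w
  proof -
    obtain s' where s': "runs (fm_com k f) (heads k w (\<lambda>_. 0)) (T (length w)) (heads k w s')"
      "s' 0 = of_bool (eval w f (\<lambda>_. 0))"
      using computesE[OF T(2) w, of "\<lambda>_. 0"] by (auto simp: normal_def)
    have "runs (Seq (init_com k) (fm_com k f)) (snd (start M w)) (poly p (length w) - 2) (heads k w s')"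
    proof (rule runs_mono)
      show "runs (Seq (init_com k) (fm_com k f)) (snd (start M w)) (7 * length w + 10 + T (length w) + 1) (heads k w s')"
        using runs_Seq[OF runs_init_com[OF w] s'(1)] assms(2) M(2) by (simp add: tapes_start)
    qed (use p[of "length w"] in simp)
    from M(3)[OF this] have "decides_within M w (nonzero 0 (map read_tape (heads k w s'))) (poly p (length w) - 2 + 2)" .
    moreover have "poly p (length w) - 2 + 2 = poly p (length w)"
      using p[of "length w"] by linarith
    moreover have "nonzero 0 (map read_tape (heads k w s')) \<longleftrightarrow> eval w f (\<lambda>_. 0)"
      using s'(2) w assms(2) by (simp add: nonzero_heads del: list.map)
    ultimately show ?thesis by (simp only:)
  qed
  moreover have "input_word (pair_input x y)" for x y
    by (auto simp: input_word_def pair_input_def symbol_def)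
  ultimately show ?thesis unfolding polytime_decidable_def using M(1) by blast
qed

section \<open>Binary representations\<close>

text \<open>Comparison at the most significant digit where the two numbers differ. It quantifies
  over digit positions only, so it stays expressible although the numbers are too large for the
  heads.\<close>

definition bits_less :: "nat \<Rightarrow> (nat \<Rightarrow> bool) \<Rightarrow> (nat \<Rightarrow> bool) \<Rightarrow> bool" where
  "bits_less l A B \<longleftrightarrow> (\<exists>b<l. \<not> A b \<and> B b \<and> (\<forall>c<l. b < c \<longrightarrow> A c = B c))"

lemma eq_iff_bits:
  fixes a b :: nat
  assumes "a < 2 ^ l" "b < 2 ^ l"
  shows "a = b \<longleftrightarrow> (\<forall>c<l. bit a c = bit b c)"
proof -
  have "a = b \<longleftrightarrow> take_bit l a = take_bit l b" using assms by (simp add: take_bit_nat_eq_self)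
  then show ?thesis by (auto simp: bit_eq_iff bit_take_bit_iff)
qed

text \<open>Induction on the number of digits, splitting off the least significant one: it decides
  only if the halves agree.\<close>

lemma less_iff_bits_less:
  fixes a b :: nat
  assumes "a < 2 ^ l" "b < 2 ^ l"
  shows "a < b \<longleftrightarrow> bits_less l (bit a) (bit b)"
  using assms
proof (induction l arbitrary: a b)
  case (Suc l)
  have lt: "a div 2 < 2 ^ l" "b div 2 < 2 ^ l" using Suc.prems by simp_all
  have "a < b \<longleftrightarrow> a div 2 < b div 2 \<or> a div 2 = b div 2 \<and> even a \<and> odd b"
    by presburger
  also have "\<dots> \<longleftrightarrow> bits_less l (bit (a div 2)) (bit (b div 2)) \<or>
      (\<forall>c<l. bit (a div 2) c = bit (b div 2) c) \<and> even a \<and> odd b"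
    using Suc.IH[OF lt] eq_iff_bits[OF lt] by simp
  also have "\<dots> \<longleftrightarrow> bits_less (Suc l) (bit a) (bit b)"
    unfolding bits_less_def Ex_less_Suc2 All_less_Suc2
    by (auto simp: bit_0 bit_Suc)
  finally show ?case .
qed (simp add: bits_less_def)

lemma binary_eq_bits: "binary t = map (bit t) [0..<length (binary t)] \<and> t < 2 ^ length (binary t)"
proof (induction t rule: binary.induct)
  case (1 t)
  show ?case
  proof (cases "t = 0")
    case False
    have *: "binary t = odd t # binary (t div 2)" using False by (subst binary.simps) simp
    have "map (bit t) [0..<Suc m] = odd t # map (bit (t div 2)) [0..<m]" for m
      by (simp add: upt_conv_Cons map_Suc_upt[symmetric] bit_0 bit_Suc del: upt_Suc)
    moreover have "t < 2 * 2 ^ length (binary (t div 2))"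
      using 1[OF False] by linarith
    ultimately show ?thesis using 1[OF False] by (simp add: * del: upt_Suc)
  qed (simp add: binary.simps)
qed

lemma last_binary: "0 < t \<Longrightarrow> binary t \<noteq> [] \<and> last (binary t)"
proof (induction t rule: binary.induct)
  case (1 t)
  have *: "binary t = odd t # binary (t div 2)" using 1 by (subst binary.simps) simp
  show ?case
  proof (cases "t div 2 = 0")
    case True
    then have "t = 1" using 1 by linarith
    then show ?thesis by (simp add: binary.simps)
  next
    case False
    then show ?thesis using 1 by (simp add: *)
  qed
qed

text \<open>Together with \<open>last_binary\<close>, this shows that ending in \<open>True\<close>
  characterizes the digit strings of positive numbers, a condition that a formula can check.\<close>

lemma binary_horner_sum: "bs = [] \<or> last bs \<Longrightarrow> binary (horner_sum of_bool 2 bs) = bs"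
proof (induction bs)
  case (Cons b bs)
  let ?h = "horner_sum of_bool 2 bs :: nat"
  have IH: "binary ?h = bs" using Cons by (cases bs) auto
  have "of_bool b + ?h * 2 \<noteq> 0"
  proof (cases bs)
    case (Cons c cs)
    then have "?h \<noteq> 0" using IH by (metis binary.simps list.discI)
    then show ?thesis by simp
  qed (use Cons.prems in simp)
  then show ?case by (subst binary.simps) (simp add: IH)
qed (simp add: binary.simps)

section \<open>Inputs and witnesses as bit strings\<close>

lemma index_less: "i < n \<Longrightarrow> j < m \<Longrightarrow> i * m + j < n * (m :: nat)"
  using mult_le_mono1[of "Suc i" n m] by simp

lemma index_div: "j < m \<Longrightarrow> (i * m + j) div m = (i :: nat)"
  by simp

text \<open>Position n + n * n + l is the last one. Its digit being \<open>True\<close>, together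
  with 0 < l, says that t is positive and written without leading zeros.\<close>

definition valid_input :: "bool list \<Rightarrow> nat \<Rightarrow> nat \<Rightarrow> bool" where
  "valid_input x n l \<longleftrightarrow> length x = n + 1 + n * n + l \<and>
     (\<forall>i<n. x ! i) \<and> \<not> x ! n \<and> 0 < l \<and> x ! (n + n * n + l) \<and>
     (\<forall>i<n. \<not> x ! (n + 1 + i * n + i)) \<and>
     (\<forall>i<n. \<forall>j<n. \<forall>k<n. x ! (n + 1 + i * n + j) \<and> x ! (n + 1 + j * n + k) \<longrightarrow> x ! (n + 1 + i * n + k))"

text \<open>
  A witness lists the values g - 1 of an order preserving map with l bits each, followed by the
  permutation matrix of a labeling.
\<close>

definition valid_witness :: "bool list \<Rightarrow> nat \<Rightarrow> nat \<Rightarrow> bool list \<Rightarrow> bool" where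
  "valid_witness x n l y \<longleftrightarrow> length y = n * l + n * n \<and>
     (\<forall>i<n. bits_less l (\<lambda>b. y ! (i * l + b)) (\<lambda>b. x ! (n + 1 + n * n + b))) \<and>
     (\<forall>i<n. \<forall>j<n. x ! (n + 1 + i * n + j) \<longrightarrow>
        \<not> bits_less l (\<lambda>b. y ! (j * l + b)) (\<lambda>b. y ! (i * l + b))) \<and>
     (\<forall>i<n. \<exists>a<n. y ! (n * l + i * n + a)) \<and>
     (\<forall>i<n. \<forall>a<n. \<forall>b<n. a < b \<longrightarrow> \<not> (y ! (n * l + i * n + a) \<and> y ! (n * l + i * n + b))) \<and>
     (\<forall>i<n. \<forall>j<n. \<forall>a<n. i < j \<longrightarrow> \<not> (y ! (n * l + i * n + a) \<and> y ! (n * l + j * n + a))) \<and>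
     (\<exists>i<n. \<exists>j<n. x ! (n + 1 + i * n + j) \<and> (\<forall>b<l. y ! (i * l + b) = y ! (j * l + b)) \<and>
        (\<exists>a<n. \<exists>b<n. b < a \<and> y ! (n * l + i * n + a) \<and> y ! (n * l + j * n + b)))"

text \<open>The position of the first \<open>False\<close> is n, and the length then determines l.
  So each input has a single notion of valid witness.\<close>

lemma valid_input_unique:
  assumes "valid_input x n l" "valid_input x n' l'"
  shows "n' = n \<and> l' = l"
proof -
  have "n' = n"
    using assms unfolding valid_input_def by (metis linorder_neqE_nat)
  moreover have "length x = n + 1 + n * n + l" "length x = n' + 1 + n' * n' + l'"
    using assms unfolding valid_input_def by blast+
  ultimately show ?thesis by simp
qed

lemma length_encode: "length (encode xs r t) = length xs + 1 + length xs * length xs + length (binary t)"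
  by (simp add: encode_def length_concat comp_def sum_list_triv)

lemma nth_encode:
  fixes xs :: "'a list"
  defines "n \<equiv> length xs"
  shows "i < n \<Longrightarrow> encode xs r t ! i"
    and "\<not> encode xs r t ! n"
    and "i < n \<Longrightarrow> j < n \<Longrightarrow> encode xs r t ! (n + 1 + i * n + j) \<longleftrightarrow> (xs ! i, xs ! j) \<in> r"
    and "encode xs r t ! (n + 1 + n * n + b) = binary t ! b"
proof -
  \<comment> \<open>The matrix read row by row is the list of all pairs, whose entry at i * n + j is
    found by division and remainder.\<close>
  have "concat (map (\<lambda>x. map (\<lambda>y. (x, y) \<in> r) xs) xs) = map (\<lambda>p. p \<in> r) (List.product xs xs)"
    by (simp add: product_concat_map map_concat comp_def)
  then have enc: "encode xs r t = (replicate n True @ [False]) @ map (\<lambda>p. p \<in> r) (List.product xs xs) @ binary t"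
    by (simp add: encode_def n_def)
  show "i < n \<Longrightarrow> encode xs r t ! i" "\<not> encode xs r t ! n"
    by (simp_all add: enc nth_append)
  show "encode xs r t ! (n + 1 + i * n + j) \<longleftrightarrow> (xs ! i, xs ! j) \<in> r" if "i < n" "j < n"
  proof -
    have "i * n + j < n * n" using that by (rule index_less)
    moreover have "(i * n + j) div n = i" "(i * n + j) mod n = j" using that by simp_all
    ultimately show ?thesis
      unfolding enc add.assoc[of "n + 1"]
      by (subst nth_append_right) (simp_all add: nth_append product_nth n_def)
  qed
  show "encode xs r t ! (n + 1 + n * n + b) = binary t ! b"
    by (simp add: enc nth_append n_def)
qed

lemma valid_input_encode:
  assumes "finite_poset (set xs) r" "1 \<le> t"
  shows "valid_input (encode xs r t) (length xs) (length (binary t))"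
proof -
  let ?n = "length xs" and ?x = "encode xs r t"
  have b: "binary t \<noteq> []" "last (binary t)" using last_binary[of t] assms(2) by auto
  \<comment> \<open>The last digit has index l - 1 after an offset of n + 1 + n * n, hence position
    n + n * n + l.\<close>
  have "?x ! (?n + ?n * ?n + length (binary t)) = binary t ! (length (binary t) - 1)"
    using nth_encode(4)[of xs r t "length (binary t) - 1"] b(1) by (cases "binary t") auto
  then have 1: "?x ! (?n + ?n * ?n + length (binary t))" using b by (simp add: last_conv_nth)
  have r: "trans r" "irrefl r" using assms(1) by (auto simp: finite_poset_def)
  note M = nth_encode(3)[of _ xs _ r t]
  have "\<forall>i<?n. \<not> ?x ! (?n + 1 + i * ?n + i)"
    using M r(2) unfolding irrefl_def by blast
  moreover have "\<forall>i<?n. \<forall>j<?n. \<forall>k<?n.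
      ?x ! (?n + 1 + i * ?n + j) \<and> ?x ! (?n + 1 + j * ?n + k) \<longrightarrow> ?x ! (?n + 1 + i * ?n + k)"
  proof (intro allI impI)
    fix i j k assume "i < ?n" "j < ?n" "k < ?n"
      and "?x ! (?n + 1 + i * ?n + j) \<and> ?x ! (?n + 1 + j * ?n + k)"
    then show "?x ! (?n + 1 + i * ?n + k)"
      using M[of i j] M[of j k] M[of i k] transD[OF r(1), of "xs ! i" "xs ! j" "xs ! k"] by blast
  qed
  ultimately show ?thesis
    unfolding valid_input_def using b(1) 1 nth_encode(1)[of _ xs r t] nth_encode(2)[of xs r t]
    by (simp only: length_encode length_greater_0_conv) blast
qed

text \<open>Ensures that strings representing nothing are rejected. Infinity of the element type
  supplies a carrier set with n elements for whatever n the string announces.\<close>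

lemma valid_input_represents:
  assumes "valid_input x n l"
  shows "\<exists>i :: ('a :: infinite) set \<times> 'a rel \<times> nat. represents x i"
proof -
  let ?M = "\<lambda>i j. x ! (n + 1 + i * n + j)"
  obtain X :: "'a set" where X: "finite X" "card X = n"
    using infinite_arbitrarily_large[OF infinite_UNIV] by blast
  obtain xs where xs: "set xs = X" "distinct xs" using finite_distinct_list[OF X(1)] by blast
  have n: "length xs = n" using xs X(2) distinct_card by fastforce
  define r where "r = {(xs ! i, xs ! j) | i j. i < n \<and> j < n \<and> ?M i j}"
  define bs where "bs = drop (n + 1 + n * n) x"
  define t where "t = (horner_sum of_bool 2 bs :: nat)"
  have len: "length x = n + 1 + n * n + l" and l: "0 < l" using assms by (auto simp: valid_input_def)
  have "length bs = l" using len by (simp add: bs_def)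
  moreover from this have "last bs"
    using assms l unfolding valid_input_def by (subst last_conv_nth) (auto simp: bs_def)
  ultimately have bin: "binary t = bs" and "bs \<noteq> []" using l by (auto simp: t_def intro!: binary_horner_sum)
  then have t: "1 \<le> t" by (cases "t = 0") (auto simp: binary.simps)
  have r: "(xs ! i, xs ! j) \<in> r \<longleftrightarrow> ?M i j" if "i < n" "j < n" for i j
    using that xs(2) n by (auto simp: r_def nth_eq_iff_index_eq)
  have "\<not> ?M i i" if "i < n" for i using assms that unfolding valid_input_def by blast
  then have "irrefl r"
    using xs(2) n by (auto simp: irrefl_def r_def nth_eq_iff_index_eq)
  moreover have "trans r"
  proof (rule transI)
    fix a b c assume "(a, b) \<in> r" "(b, c) \<in> r"
    then obtain i j k where "a = xs ! i" "b = xs ! j" "c = xs ! k" "i < n" "j < n" "k < n" "?M i j" "?M j k"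
      using xs(2) n by (auto simp: r_def nth_eq_iff_index_eq)
    moreover from this have "?M i k" using assms unfolding valid_input_def by blast
    ultimately show "(a, c) \<in> r" by (auto simp: r_def)
  qed
  moreover have "r \<subseteq> X \<times> X" using xs(1) n by (auto simp: r_def)
  ultimately have poset: "finite_poset X r" using X(1) by (simp add: finite_poset_def)
  have "x = encode xs r t"
  proof (rule nth_equalityI)
    show "length x = length (encode xs r t)"
      using len \<open>length bs = l\<close> by (simp add: length_encode n bin)
    fix k assume k: "k < length x"
    consider "k < n" | "k = n" | m where "k = n + 1 + m" "m < n * n" | b where "k = n + 1 + n * n + b" "b < l"
    proof -
      have "k < n \<or> k = n \<or> (\<exists>m. k = n + 1 + m \<and> m < n * n) \<or> (\<exists>b. k = n + 1 + n * n + b \<and> b < l)"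
      proof (cases "k < n + 1 + n * n")
        case True
        then show ?thesis by (cases "k \<le> n") (auto intro!: exI[of _ "k - (n + 1)"])
      next
        case False
        then show ?thesis using k len by (auto intro!: exI[of _ "k - (n + 1 + n * n)"])
      qed
      then show thesis using that by blast
    qed
    then show "x ! k = encode xs r t ! k"
    proof cases
      case 1
      moreover from this have "x ! k" using assms unfolding valid_input_def by blast
      ultimately show ?thesis using nth_encode(1)[of k xs r t] n by simp
    next
      case 2
      moreover from this have "\<not> x ! k" using assms unfolding valid_input_def by blast
      ultimately show ?thesis using nth_encode(2)[of xs r t] n by simp
    next
      case (3 m)
      then have "0 < n" by (cases n) auto
      then have "m div n < n" "m mod n < n" "n + 1 + m div n * n + m mod n = k"
        using 3 by (simp_all add: less_mult_imp_div_less)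
      then show ?thesis using nth_encode(3)[of "m div n" xs "m mod n" r t] r[of "m div n" "m mod n"] n by simp
    next
      case (4 b)
      then show ?thesis using nth_encode(4)[of xs r t b] n len by (simp add: bin bs_def)
    qed
  qed
  then show ?thesis using poset t xs by (intro exI[of _ "(X, r, t)"]) (auto simp: represents_def)
qed

section \<open>Encoding and decoding of witnesses\<close>

text \<open>Subtracting 1 makes the values 1 to 2^l fit exactly into l digits. \<open>Suc\<close>
  occurs because matrix columns count from 0 and labels from 1.\<close>

definition witness :: "'a list \<Rightarrow> nat \<Rightarrow> ('a \<Rightarrow> nat) \<times> ('a \<Rightarrow> nat) \<Rightarrow> bool list" where
  "witness xs l = (\<lambda>(g, \<tau>). map (\<lambda>k. if k < length xs * l then bit (g (xs ! (k div l)) - 1) (k mod l)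
       else \<tau> (xs ! ((k - length xs * l) div length xs)) = Suc ((k - length xs * l) mod length xs))
     [0..<length xs * l + length xs * length xs])"

lemma length_witness: "length (witness xs l p) = length xs * l + length xs * length xs"
  by (simp add: witness_def split: prod.split)

lemma nth_witness:
  assumes "i < length xs"
  shows "b < l \<Longrightarrow> witness xs l (g, \<tau>) ! (i * l + b) \<longleftrightarrow> bit (g (xs ! i) - 1) b"
    and "a < length xs \<Longrightarrow> witness xs l (g, \<tau>) ! (length xs * l + i * length xs + a) \<longleftrightarrow> \<tau> (xs ! i) = Suc a"
proof -
  show "witness xs l (g, \<tau>) ! (i * l + b) \<longleftrightarrow> bit (g (xs ! i) - 1) b" if "b < l"
    using index_less[OF assms that] that by (simp add: witness_def)
  show "witness xs l (g, \<tau>) ! (length xs * l + i * length xs + a) \<longleftrightarrow> \<tau> (xs ! i) = Suc a"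
    if "a < length xs"
  proof -
    have "(i * length xs + a) div length xs = i" using that by (rule index_div)
    then show ?thesis using index_less[OF assms that] that by (simp add: witness_def add.assoc)
  qed
qed

lemma bits_less_cong:
  "(\<And>b. b < l \<Longrightarrow> A b = A' b) \<Longrightarrow> (\<And>b. b < l \<Longrightarrow> B b = B' b) \<Longrightarrow> bits_less l A B = bits_less l A' B'"
  by (auto simp: bits_less_def)

text \<open>The domain admits values up to 2^l rather than t, since this is the range of decoded
  digit blocks before the bound t has been checked.\<close>

lemma inj_on_witness:
  "inj_on (witness xs l) ((set xs \<rightarrow>\<^sub>E {1..2 ^ l}) \<times> (set xs \<rightarrow>\<^sub>E {1..length xs}))"
proof (rule inj_onI, clarify)
  fix g \<tau> g' \<tau>'
  assume g: "g \<in> set xs \<rightarrow>\<^sub>E {1..2 ^ l}" "g' \<in> set xs \<rightarrow>\<^sub>E {1..2 ^ l}"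
    and \<tau>: "\<tau> \<in> set xs \<rightarrow>\<^sub>E {1..length xs}" "\<tau>' \<in> set xs \<rightarrow>\<^sub>E {1..length xs}"
    and eq: "witness xs l (g, \<tau>) = witness xs l (g', \<tau>')"
  have "g (xs ! i) = g' (xs ! i)" if i: "i < length xs" for i
  proof -
    have "\<forall>b<l. bit (g (xs ! i) - 1) b = bit (g' (xs ! i) - 1) b"
      using nth_witness(1)[OF i] eq by metis
    moreover have G: "g (xs ! i) \<in> {1..2 ^ l}" "g' (xs ! i) \<in> {1..2 ^ l}"
      using g i by (auto simp: PiE_iff)
    then have "g (xs ! i) - 1 < 2 ^ l" "g' (xs ! i) - 1 < 2 ^ l" by auto
    ultimately have "g (xs ! i) - 1 = g' (xs ! i) - 1" using eq_iff_bits by blast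
    then show ?thesis using G by auto
  qed
  then have "g x = g' x" if "x \<in> set xs" for x using that by (metis in_set_conv_nth)
  then have "g = g'" using g by (intro extensionalityI[of g "set xs"]) (auto simp: PiE_def)
  moreover have "\<tau> (xs ! i) = \<tau>' (xs ! i)" if i: "i < length xs" for i
  proof -
    have "\<tau> (xs ! i) \<in> {1..length xs}" using \<tau>(1) i by (auto simp: PiE_iff)
    then obtain a where a: "\<tau> (xs ! i) = Suc a" "a < length xs" by (cases "\<tau> (xs ! i)") auto
    then show ?thesis using nth_witness(2)[OF i a(2)] eq by metis
  qed
  then have "\<tau> x = \<tau>' x" if "x \<in> set xs" for x using that by (metis in_set_conv_nth)
  then have "\<tau> = \<tau>'" using \<tau> by (intro extensionalityI[of \<tau> "set xs"]) (auto simp: PiE_def)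
  ultimately show "g = g' \<and> \<tau> = \<tau>'" ..
qed

text \<open>The conditions on single matrix rows hold for every encoded pair. The others translate
  one by one: values at most t, monotonicity, injectivity of the labels, and an actual violation. As
  g - 1 is stored, a strict comparison with t expresses g \<le> t.\<close>

lemma valid_witness_witness:
  fixes xs :: "'a list"
  defines "n \<equiv> length xs"
  assumes xs: "distinct xs" and r: "r \<subseteq> set xs \<times> set xs"
    and g: "g \<in> set xs \<rightarrow>\<^sub>E {1..2 ^ length (binary t)}" and \<tau>: "\<tau> \<in> set xs \<rightarrow>\<^sub>E {1..n}"
  shows "valid_witness (encode xs r t) n (length (binary t)) (witness xs (length (binary t)) (g, \<tau>)) \<longleftrightarrow>
    (g, \<tau>) \<in> violations (set xs) r t"
proof -
  let ?l = "length (binary t)"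
  let ?x = "encode xs r t" and ?y = "witness xs ?l (g, \<tau>)"
  have G: "g (xs ! i) \<in> {1..2 ^ ?l}" and T: "\<tau> (xs ! i) \<in> {1..n}" if "i < n" for i
    using g \<tau> that by (auto simp: PiE_iff n_def)
  have label: "\<exists>a<n. \<tau> (xs ! i) = Suc a" if "i < n" for i
    using T[OF that] by (cases "\<tau> (xs ! i)") auto
  have t: "t < 2 ^ ?l" and tb: "\<And>b. b < ?l \<Longrightarrow> binary t ! b = bit t b"
    using binary_eq_bits[of t] by (metis, metis add_0 nth_map_upt diff_zero)
  have g_lt: "g (xs ! i) - 1 < 2 ^ ?l" if "i < n" for i using G[OF that] by auto
  have M: "?x ! (n + 1 + i * n + j) \<longleftrightarrow> (xs ! i, xs ! j) \<in> r" if "i < n" "j < n" for i j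
    using nth_encode(3)[of i xs j r t] that unfolding n_def by blast
  have Y: "?y ! (i * ?l + b) \<longleftrightarrow> bit (g (xs ! i) - 1) b" if "i < n" "b < ?l" for i b
    using nth_witness(1)[of i xs b ?l g \<tau>] that unfolding n_def by blast
  have P: "?y ! (n * ?l + i * n + a) \<longleftrightarrow> \<tau> (xs ! i) = Suc a" if "i < n" "a < n" for i a
    using nth_witness(2)[of i xs a ?l g \<tau>] that unfolding n_def by blast
  have ex_set: "(\<exists>x\<in>set xs. Q x) \<longleftrightarrow> (\<exists>i<n. Q (xs ! i))" for Q
    unfolding n_def by (metis in_set_conv_nth)
  have all_set: "(\<forall>x\<in>set xs. Q x) \<longleftrightarrow> (\<forall>i<n. Q (xs ! i))" for Q
    unfolding n_def by (metis in_set_conv_nth)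
  have all_r: "(\<forall>(x, y)\<in>r. Q x y) \<longleftrightarrow> (\<forall>i<n. \<forall>j<n. (xs ! i, xs ! j) \<in> r \<longrightarrow> Q (xs ! i) (xs ! j))" for Q
  proof -
    have "(\<forall>(x, y)\<in>r. Q x y) \<longleftrightarrow> (\<forall>x\<in>set xs. \<forall>y\<in>set xs. (x, y) \<in> r \<longrightarrow> Q x y)" using r by fast
    then show ?thesis by (simp only: all_set)
  qed
  have ex_r: "(\<exists>(x, y)\<in>r. Q x y) \<longleftrightarrow> (\<exists>i<n. \<exists>j<n. (xs ! i, xs ! j) \<in> r \<and> Q (xs ! i) (xs ! j))" for Q
    using all_r[of "\<lambda>x y. \<not> Q x y"] by fast
  have less: "bits_less ?l (\<lambda>b. ?y ! (i * ?l + b)) (\<lambda>b. ?y ! (j * ?l + b)) \<longleftrightarrow> g (xs ! i) < g (xs ! j)"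
    if "i < n" "j < n" for i j
  proof -
    have "bits_less ?l (\<lambda>b. ?y ! (i * ?l + b)) (\<lambda>b. ?y ! (j * ?l + b)) \<longleftrightarrow>
        bits_less ?l (bit (g (xs ! i) - 1)) (bit (g (xs ! j) - 1))"
      using Y that by (intro bits_less_cong) auto
    also have "\<dots> \<longleftrightarrow> g (xs ! i) - 1 < g (xs ! j) - 1"
      using less_iff_bits_less g_lt that by metis
    finally show ?thesis using G[OF that(1)] G[OF that(2)] by auto
  qed
  have less_t: "bits_less ?l (\<lambda>b. ?y ! (i * ?l + b)) (\<lambda>b. ?x ! (n + 1 + n * n + b)) \<longleftrightarrow> g (xs ! i) \<le> t"
    if "i < n" for i
  proof -
    have "bits_less ?l (\<lambda>b. ?y ! (i * ?l + b)) (\<lambda>b. ?x ! (n + 1 + n * n + b)) \<longleftrightarrow>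
        bits_less ?l (bit (g (xs ! i) - 1)) (bit t)"
      using Y that tb nth_encode(4)[of xs r t] unfolding n_def by (intro bits_less_cong) auto
    also have "\<dots> \<longleftrightarrow> g (xs ! i) - 1 < t"
      using less_iff_bits_less g_lt t that by metis
    finally show ?thesis using G[OF that] by auto
  qed
  have same: "(\<forall>b<?l. ?y ! (i * ?l + b) = ?y ! (j * ?l + b)) \<longleftrightarrow> g (xs ! i) = g (xs ! j)"
    if "i < n" "j < n" for i j
  proof -
    have "(\<forall>b<?l. ?y ! (i * ?l + b) = ?y ! (j * ?l + b)) \<longleftrightarrow> g (xs ! i) - 1 = g (xs ! j) - 1"
      using Y that eq_iff_bits[OF g_lt g_lt, of i j] by auto
    then show ?thesis using G[OF that(1)] G[OF that(2)] by auto
  qed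
  have 1: "(\<forall>i<n. bits_less ?l (\<lambda>b. ?y ! (i * ?l + b)) (\<lambda>b. ?x ! (n + 1 + n * n + b))) \<longleftrightarrow> g \<in> set xs \<rightarrow>\<^sub>E {1..t}"
  proof -
    have "g \<in> set xs \<rightarrow>\<^sub>E {1..t} \<longleftrightarrow> (\<forall>x\<in>set xs. g x \<le> t)"
      using g by (auto simp: PiE_iff)
    then show ?thesis using less_t by (auto simp: all_set)
  qed
  have 2: "(\<forall>i<n. \<forall>j<n. ?x ! (n + 1 + i * n + j) \<longrightarrow>
        \<not> bits_less ?l (\<lambda>b. ?y ! (j * ?l + b)) (\<lambda>b. ?y ! (i * ?l + b))) \<longleftrightarrow> (\<forall>(x, y)\<in>r. g x \<le> g y)"
    unfolding all_r using M less by (auto simp: not_less)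
  have 3: "\<forall>i<n. \<exists>a<n. ?y ! (n * ?l + i * n + a)"
    using label P by blast
  have 4: "\<forall>i<n. \<forall>a<n. \<forall>b<n. a < b \<longrightarrow> \<not> (?y ! (n * ?l + i * n + a) \<and> ?y ! (n * ?l + i * n + b))"
    using P by auto
  have 5: "(\<forall>i<n. \<forall>j<n. \<forall>a<n. i < j \<longrightarrow> \<not> (?y ! (n * ?l + i * n + a) \<and> ?y ! (n * ?l + j * n + a))) \<longleftrightarrow>
      \<tau> \<in> labelings (set xs)"
  proof -
    have card: "card (set xs) = n" using xs by (simp add: n_def distinct_card)
    have "\<tau> \<in> labelings (set xs) \<longleftrightarrow> inj_on \<tau> (set xs)"
      using \<tau> by (simp add: labelings_eq_inj card)
    also have "\<dots> \<longleftrightarrow> (\<forall>i<n. \<forall>j<n. i < j \<longrightarrow> \<tau> (xs ! i) \<noteq> \<tau> (xs ! j))"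
    proof
      assume "inj_on \<tau> (set xs)"
      then show "\<forall>i<n. \<forall>j<n. i < j \<longrightarrow> \<tau> (xs ! i) \<noteq> \<tau> (xs ! j)"
        using xs by (auto simp: n_def inj_on_eq_iff nth_eq_iff_index_eq)
    next
      assume *: "\<forall>i<n. \<forall>j<n. i < j \<longrightarrow> \<tau> (xs ! i) \<noteq> \<tau> (xs ! j)"
      show "inj_on \<tau> (set xs)"
      proof (rule inj_onI)
        fix x y assume "x \<in> set xs" "y \<in> set xs" and eq: "\<tau> x = \<tau> y"
        then obtain i j where ij: "i < n" "j < n" "x = xs ! i" "y = xs ! j"
          unfolding n_def by (metis in_set_conv_nth)
        then show "x = y" using * eq by (metis linorder_neqE_nat)
      qed
    qed
    also have "\<dots> \<longleftrightarrow> (\<forall>i<n. \<forall>j<n. \<forall>a<n. i < j \<longrightarrow>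
        \<not> (?y ! (n * ?l + i * n + a) \<and> ?y ! (n * ?l + j * n + a)))"
    proof -
      have "(\<forall>a<n. \<not> (?y ! (n * ?l + i * n + a) \<and> ?y ! (n * ?l + j * n + a))) \<longleftrightarrow> \<tau> (xs ! i) \<noteq> \<tau> (xs ! j)"
        if "i < n" "j < n" for i j
      proof -
        obtain a where "\<tau> (xs ! i) = Suc a" "a < n" using label \<open>i < n\<close> by blast
        then show ?thesis using P that by auto
      qed
      then show ?thesis by blast
    qed
    finally show ?thesis by blast
  qed
  have 6: "(\<exists>i<n. \<exists>j<n. ?x ! (n + 1 + i * n + j) \<and> (\<forall>b<?l. ?y ! (i * ?l + b) = ?y ! (j * ?l + b)) \<and>
        (\<exists>a<n. \<exists>b<n. b < a \<and> ?y ! (n * ?l + i * n + a) \<and> ?y ! (n * ?l + j * n + b))) \<longleftrightarrow>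
      (\<exists>(x, y)\<in>r. g x = g y \<and> \<tau> y < \<tau> x)"
  proof -
    have inv: "(\<exists>a<n. \<exists>b<n. b < a \<and> ?y ! (n * ?l + i * n + a) \<and> ?y ! (n * ?l + j * n + b)) \<longleftrightarrow>
        \<tau> (xs ! j) < \<tau> (xs ! i)" if "i < n" "j < n" for i j
    proof -
      obtain a where "\<tau> (xs ! i) = Suc a" "a < n" using label \<open>i < n\<close> by blast
      moreover obtain b where "\<tau> (xs ! j) = Suc b" "b < n" using label \<open>j < n\<close> by blast
      ultimately show ?thesis using P that by auto
    qed
    show ?thesis
      unfolding ex_r by (intro ex_cong1 conj_cong refl) (simp_all only: M same inv)
  qed
  have "length ?y = n * ?l + n * n" by (simp add: length_witness n_def)
  then show ?thesis
    unfolding valid_witness_def 1 2 5 6 using 3 4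
    by (auto simp: violations_def order_maps_def)
qed

text \<open>Decoding: blocks of l digits are read as numbers, and the unique mark in each row of the
  matrix gives the label. No accepted string lies outside the range of
  \<open>witness\<close>.\<close>

lemma valid_witness_imp_witness:
  assumes xs: "distinct xs" and y: "valid_witness x (length xs) l y"
  obtains g \<tau> where "g \<in> set xs \<rightarrow>\<^sub>E {1..2 ^ l}" "\<tau> \<in> set xs \<rightarrow>\<^sub>E {1..length xs}" "y = witness xs l (g, \<tau>)"
proof -
  let ?n = "length xs"
  define idx where "idx = inv_into {..<?n} ((!) xs)"
  have idx: "idx (xs ! i) = i" if "i < ?n" for i
    using that xs by (auto simp: idx_def inj_on_def nth_eq_iff_index_eq intro!: inv_into_f_eq)
  have len: "length y = ?n * l + ?n * ?n"
    and row: "\<And>i. i < ?n \<Longrightarrow> \<exists>a<?n. y ! (?n * l + i * ?n + a)"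
    and row_unique: "\<And>i a b. i < ?n \<Longrightarrow> a < ?n \<Longrightarrow> b < ?n \<Longrightarrow> a < b \<Longrightarrow>
      y ! (?n * l + i * ?n + a) \<Longrightarrow> \<not> y ! (?n * l + i * ?n + b)"
    using y unfolding valid_witness_def by blast+
  define \<gamma> where "\<gamma> i = (horner_sum of_bool 2 (map (\<lambda>b. y ! (i * l + b)) [0..<l]) :: nat)" for i
  have \<gamma>: "\<gamma> i < 2 ^ l" "\<And>b. b < l \<Longrightarrow> bit (\<gamma> i) b = y ! (i * l + b)" for i
    using horner_sum_of_bool_2_less[of "map (\<lambda>b. y ! (i * l + b)) [0..<l]"]
    by (simp_all add: \<gamma>_def bit_horner_sum_bit_iff)
  obtain \<pi> where \<pi>: "\<And>i. i < ?n \<Longrightarrow> \<pi> i < ?n \<and> y ! (?n * l + i * ?n + \<pi> i)"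
    using row by metis
  have \<pi>_iff: "y ! (?n * l + i * ?n + a) \<longleftrightarrow> a = \<pi> i" if "i < ?n" "a < ?n" for i a
    using \<pi>[OF that(1)] row_unique[OF that(1), of a "\<pi> i"] row_unique[OF that(1), of "\<pi> i" a] that(2)
    by (metis linorder_neqE_nat)
  define g where "g = restrict (\<lambda>x. Suc (\<gamma> (idx x))) (set xs)"
  define \<tau> where "\<tau> = restrict (\<lambda>x. Suc (\<pi> (idx x))) (set xs)"
  have "idx x < ?n" if "x \<in> set xs" for x
    using that idx by (metis in_set_conv_nth)
  then have "g \<in> set xs \<rightarrow>\<^sub>E {1..2 ^ l}" "\<tau> \<in> set xs \<rightarrow>\<^sub>E {1..?n}"
    using \<gamma>(1) \<pi> by (auto simp: g_def \<tau>_def Suc_le_eq)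
  moreover have "y = witness xs l (g, \<tau>)"
  proof (rule nth_equalityI)
    show "length y = length (witness xs l (g, \<tau>))" by (simp add: len length_witness)
    fix k assume k: "k < length y"
    show "y ! k = witness xs l (g, \<tau>) ! k"
    proof (cases "k < ?n * l")
      case True
      \<comment> \<open>Secures that division by l recovers the row and the digit of k.\<close>
      then have "0 < l" by (cases l) auto
      then have i: "k div l < ?n" "k mod l < l" using True by (simp_all add: less_mult_imp_div_less)
      show ?thesis
        using nth_witness(1)[OF i, of g \<tau>] \<gamma>(2)[OF i(2), of "k div l"] i(1) by (simp add: g_def idx)
    next
      case False
      define m where "m = k - ?n * l"
      have m: "k = ?n * l + m" "m < ?n * ?n" using False k len by (auto simp: m_def)
      then have "0 < ?n" by (cases "?n") auto
      then have i: "m div ?n < ?n" "m mod ?n < ?n" using m(2) by (simp_all add: less_mult_imp_div_less)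
      have "k = ?n * l + m div ?n * ?n + m mod ?n" by (simp add: m(1) add.assoc)
      then show ?thesis
        using nth_witness(2)[OF i, of l g \<tau>] \<pi>_iff[OF i] i(1) by (auto simp: \<tau>_def idx)
    qed
  qed
  ultimately show thesis using that by blast
qed

text \<open>Encoding is injective on violations, because t < 2^l puts them into the domain of
  \<open>inj_on_witness\<close>, and decoding makes it onto.\<close>

lemma card_valid_witness:
  assumes "distinct xs" "finite_poset (set xs) r"
  shows "card {y. valid_witness (encode xs r t) (length xs) (length (binary t)) y} =
    card (violations (set xs) r t)"
proof -
  let ?l = "length (binary t)"
  let ?V = "violations (set xs) r t" and ?C = "(set xs \<rightarrow>\<^sub>E {1..2 ^ ?l}) \<times> (set xs \<rightarrow>\<^sub>E {1..length xs})"
  have r: "r \<subseteq> set xs \<times> set xs" using assms(2) by (simp add: finite_poset_def)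
  have "t < 2 ^ ?l" using binary_eq_bits by blast
  then have "(set xs \<rightarrow>\<^sub>E {1..t}) \<subseteq> (set xs \<rightarrow>\<^sub>E {1..2 ^ ?l})" by (intro PiE_mono) auto
  moreover have "?V \<subseteq> (set xs \<rightarrow>\<^sub>E {1..t}) \<times> (set xs \<rightarrow>\<^sub>E {1..length xs})"
    using distinct_card[OF assms(1)] by (auto simp: violations_def order_maps_def labelings_def)
  ultimately have sub: "?V \<subseteq> ?C" by blast
  have "{y. valid_witness (encode xs r t) (length xs) ?l y} = witness xs ?l ` ?V"
  proof (intro subset_antisym subsetI)
    fix y assume y: "y \<in> {y. valid_witness (encode xs r t) (length xs) ?l y}"
    then obtain g \<tau> where "g \<in> set xs \<rightarrow>\<^sub>E {1..2 ^ ?l}" "\<tau> \<in> set xs \<rightarrow>\<^sub>E {1..length xs}" "y = witness xs ?l (g, \<tau>)"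
      using valid_witness_imp_witness[OF assms(1)] by blast
    then show "y \<in> witness xs ?l ` ?V" using valid_witness_witness[OF assms(1) r] y by blast
  next
    fix y assume "y \<in> witness xs ?l ` ?V"
    then obtain g \<tau> where "(g, \<tau>) \<in> ?V" "y = witness xs ?l (g, \<tau>)" by auto
    moreover from this sub have "g \<in> set xs \<rightarrow>\<^sub>E {1..2 ^ ?l}" "\<tau> \<in> set xs \<rightarrow>\<^sub>E {1..length xs}" by auto
    ultimately show "y \<in> {y. valid_witness (encode xs r t) (length xs) ?l y}"
      using valid_witness_witness[OF assms(1) r] by blast
  qed
  then show ?thesis using card_image[OF inj_on_subset[OF inj_on_witness sub]] by simp
qed

section \<open>A formula for valid inputs with valid witnesses\<close>

definition Imp :: "fm \<Rightarrow> fm \<Rightarrow> fm" where "Imp f g = Neg (And f (Neg g))"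

definition Iff :: "fm \<Rightarrow> fm \<Rightarrow> fm" where "Iff f g = And (Imp f g) (Imp g f)"

definition Exb :: "nat \<Rightarrow> nat \<Rightarrow> fm \<Rightarrow> fm" where
  "Exb i z f = Ex i (And (Less [Var i] z) f)"

definition Allb :: "nat \<Rightarrow> nat \<Rightarrow> fm \<Rightarrow> fm" where
  "Allb i z f = Neg (Exb i z (Neg f))"

text \<open>
  Variables 4 and 5 are the number n of elements and the number l of digits of t.  The digit
  with index k of the input is at position k + 1, and that of the witness at position
  (n + 1 + n * n + l) + 2 + k.
\<close>

definition input_bit :: "monomial list \<Rightarrow> fm" where
  "input_bit t = Sym (One # t) 2"

definition witness_bit :: "monomial list \<Rightarrow> fm" where
  "witness_bit t = Sym ([One, One, One, Var 4, Prod 4 4, Var 5] @ t) 2"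

definition rel_f :: "nat \<Rightarrow> nat \<Rightarrow> fm" where
  "rel_f i j = input_bit [Var 4, One, Prod i 4, Var j]"

definition bound_f :: "nat \<Rightarrow> fm" where
  "bound_f b = input_bit [Var 4, One, Prod 4 4, Var b]"

definition value_f :: "nat \<Rightarrow> nat \<Rightarrow> fm" where
  "value_f i b = witness_bit [Prod i 5, Var b]"

definition label_f :: "nat \<Rightarrow> nat \<Rightarrow> fm" where
  "label_f i a = witness_bit [Prod 4 5, Prod i 4, Var a]"

text \<open>The formula for \<open>bits_less\<close>. It reserves 9 and 10 for its own quantifiers,
  so its operands may otherwise mention only 4 to 8.\<close>

definition less_f :: "(nat \<Rightarrow> fm) \<Rightarrow> (nat \<Rightarrow> fm) \<Rightarrow> fm" where
  "less_f A B = Exb 9 5 (And (Neg (A 9)) (And (B 9)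
     (Allb 10 5 (Imp (Less [Var 9] 10) (Iff (A 10) (B 10))))))"

text \<open>The separator fixes the length of the input. The total length is pinned down by its last
  position not being blank while the next one is.\<close>

definition size_f :: fm where
  "size_f = And (Sym [One, One, Var 4, Prod 4 4, Var 5] 3)
     (And (Neg (Sym [One, One, Var 4, Prod 4 4, Var 5, Prod 4 5, Prod 4 4] 0))
          (Sym [One, One, One, Var 4, Prod 4 4, Var 5, Prod 4 5, Prod 4 4] 0))"

definition input_f :: fm where
  "input_f =
     And (Allb 6 4 (input_bit [Var 6]))
    (And (Neg (input_bit [Var 4]))
    (And (Less [] 5)
    (And (input_bit [Var 4, Prod 4 4, Var 5])
    (And (Allb 6 4 (Neg (rel_f 6 6)))
         (Allb 6 4 (Allb 7 4 (Allb 8 4 (Imp (And (rel_f 6 7) (rel_f 7 8)) (rel_f 6 8)))))))))"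

definition witness_f :: fm where
  "witness_f =
     And (Allb 6 4 (less_f (value_f 6) bound_f))
    (And (Allb 6 4 (Allb 7 4 (Imp (rel_f 6 7) (Neg (less_f (value_f 7) (value_f 6))))))
    (And (Allb 6 4 (Exb 7 4 (label_f 6 7)))
    (And (Allb 6 4 (Allb 7 4 (Allb 8 4 (Imp (Less [Var 7] 8) (Neg (And (label_f 6 7) (label_f 6 8)))))))
    (And (Allb 6 4 (Allb 7 4 (Allb 8 4 (Imp (Less [Var 6] 7) (Neg (And (label_f 6 8) (label_f 7 8)))))))
         (Exb 6 4 (Exb 7 4 (And (rel_f 6 7)
            (And (Allb 8 5 (Iff (value_f 6 8) (value_f 7 8)))
                 (Exb 8 4 (Exb 9 4 (And (Less [Var 9] 8) (And (label_f 6 8) (label_f 7 9)))))))))))))"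

definition verifier_f :: fm where
  "verifier_f = Ex 4 (Ex 5 (And size_f (And input_f witness_f)))"

text \<open>The variables are 4 to 10, hence eleven tapes.\<close>

lemma scoped_verifier_f: "scoped 11 {} verifier_f"
  by (simp add: verifier_f_def size_f_def input_f_def witness_f_def less_f_def value_f_def label_f_def
      rel_f_def bound_f_def input_bit_def witness_bit_def Allb_def Exb_def Imp_def Iff_def)

lemma eval_Imp [simp]: "eval w (Imp f g) s \<longleftrightarrow> (eval w f s \<longrightarrow> eval w g s)"
  by (simp add: Imp_def)

lemma eval_Iff [simp]: "eval w (Iff f g) s \<longleftrightarrow> (eval w f s \<longleftrightarrow> eval w g s)"
  by (auto simp: Iff_def)

text \<open>The bound on \<open>s z\<close> keeps all values below it within reach of
  \<open>Ex\<close>; with i = z the binding would overwrite its own bound.\<close>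

lemma eval_Exb:
  "i \<noteq> z \<Longrightarrow> s z \<le> length w \<Longrightarrow> eval w (Exb i z f) s \<longleftrightarrow> (\<exists>a<s z. eval w f (s(i := a)))"
  by (simp add: Exb_def term_val_def) (meson less_imp_le less_le_trans)

lemma eval_Allb:
  "i \<noteq> z \<Longrightarrow> s z \<le> length w \<Longrightarrow> eval w (Allb i z f) s \<longleftrightarrow> (\<forall>a<s z. eval w f (s(i := a)))"
  by (simp add: Allb_def eval_Exb)

text \<open>The operands are evaluated after 9 and 10 have been rebound, so their meaning is
  required for every assignment that agrees with \<open>s\<close> on 4 to 8.\<close>

lemma eval_less_f:
  assumes "s 5 = l" "l \<le> length w"
    and A: "\<And>k s'. k \<in> {9, 10} \<Longrightarrow> s' k < l \<Longrightarrow> (\<And>j. j \<in> {4..8} \<Longrightarrow> s' j = s j) \<Longrightarrow> eval w (A k) s' \<longleftrightarrow> P (s' k)"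
    and B: "\<And>k s'. k \<in> {9, 10} \<Longrightarrow> s' k < l \<Longrightarrow> (\<And>j. j \<in> {4..8} \<Longrightarrow> s' j = s j) \<Longrightarrow> eval w (B k) s' \<longleftrightarrow> Q (s' k)"
  shows "eval w (less_f A B) s \<longleftrightarrow> bits_less l P Q"
proof -
  have "eval w (A 9) (s(9 := b)) \<longleftrightarrow> P b" "eval w (B 9) (s(9 := b)) \<longleftrightarrow> Q b"
    "eval w (A 10) (s(9 := c, 10 := b)) \<longleftrightarrow> P b" "eval w (B 10) (s(9 := c, 10 := b)) \<longleftrightarrow> Q b" if "b < l" for b c
    using that A[of 9 "s(9 := b)"] B[of 9 "s(9 := b)"]
      A[of 10 "s(9 := c, 10 := b)"] B[of 10 "s(9 := c, 10 := b)"] by simp_all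
  then show ?thesis
    unfolding less_f_def bits_less_def using assms(1,2)
    by (simp add: eval_Exb eval_Allb term_val_def cong: conj_cong)
qed

lemma length_pair_input: "length (pair_input x y) = length x + 1 + length y"
  by (simp add: pair_input_def)

lemma input_word_pair_input: "input_word (pair_input x y)"
  by (auto simp: input_word_def pair_input_def symbol_def)

lemma symbol_at_pair_input:
  "k < length x \<Longrightarrow> symbol_at (pair_input x y) (Suc k) = symbol (x ! k)"
  "k < length y \<Longrightarrow> symbol_at (pair_input x y) (length x + 2 + k) = symbol (y ! k)"
  by (simp_all add: symbol_at_def pair_input_def nth_append)

text \<open>Digits are 1 or 2, the marker is 4 and blanks are 0, so 3 occurs nowhere else.\<close>

lemma symbol_at_separator: "symbol_at (pair_input x y) v = 3 \<longleftrightarrow> v = length x + 1"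
proof -
  consider "v = 0" | k where "v = Suc k" "k < length x" | "v = length x + 1"
    | k where "v = length x + 2 + k" "k < length y" | "length (pair_input x y) < v"
  proof -
    have "v = 0 \<or> (\<exists>k<length x. v = Suc k) \<or> v = length x + 1 \<or>
      (\<exists>k<length y. v = length x + 2 + k) \<or> length (pair_input x y) < v"
      unfolding length_pair_input by (cases v) (auto, presburger)
    then show thesis using that by blast
  qed
  then show ?thesis
  proof cases
    case 3
    then show ?thesis by (simp add: symbol_at_def pair_input_def nth_append)
  next
    case 5
    then show ?thesis by (simp add: symbol_at_def length_pair_input)
  qed (auto simp: symbol_at_pair_input[simplified] symbol_at_def[of _ 0] symbol_def)
qed

lemma eval_size_f:
  assumes "s 4 = n" "s 5 = l"
  shows "eval (pair_input x y) size_f s \<longleftrightarrow>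
    length x = n + 1 + n * n + l \<and> length y = n * l + n * n"
  using assms
  by (auto simp: size_f_def symbol_at_separator symbol_at_eq_0[OF input_word_pair_input]
      length_pair_input term_val_def)

section \<open>Meaning of the formulas once the lengths fit, so that every address falls into the
  intended string\<close>

context
  fixes x y :: "bool list" and n l :: nat
  assumes len_x: "length x = n + 1 + n * n + l" and len_y: "length y = n * l + n * n"
begin

lemma bounds: "n \<le> length (pair_input x y)" "l \<le> length (pair_input x y)"
  by (simp_all add: length_pair_input len_x)

lemma eval_input_bit:
  "term_val s t < length x \<Longrightarrow> eval (pair_input x y) (input_bit t) s \<longleftrightarrow> x ! term_val s t"
  using symbol_at_pair_input(1)[of "term_val s t" x y]
  by (simp add: input_bit_def symbol_def term_val_def)

lemma eval_witness_bit:
  assumes "s 4 = n" "s 5 = l" "term_val s t < length y"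
  shows "eval (pair_input x y) (witness_bit t) s \<longleftrightarrow> y ! term_val s t"
proof -
  have "term_val s ([One, One, One, Var 4, Prod 4 4, Var 5] @ t) = length x + 2 + term_val s t"
    by (simp add: term_val_def len_x assms)
  then show ?thesis
    using symbol_at_pair_input(2)[OF assms(3), of x]
    by (simp add: witness_bit_def symbol_def del: append.simps add_2_eq_Suc')
qed

lemma eval_rel_f:
  assumes "s 4 = n" "s i < n" "s j < n"
  shows "eval (pair_input x y) (rel_f i j) s \<longleftrightarrow> x ! (n + 1 + s i * n + s j)"
proof -
  have "term_val s [Var 4, One, Prod i 4, Var j] = n + 1 + s i * n + s j"
    by (simp add: term_val_def assms)
  moreover have "n + 1 + s i * n + s j < length x"
    using index_less[OF assms(2,3)] by (simp add: len_x)
  ultimately show ?thesis unfolding rel_f_def by (subst eval_input_bit) simp_all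
qed

lemma eval_bound_f:
  assumes "s 4 = n" "s b < l"
  shows "eval (pair_input x y) (bound_f b) s \<longleftrightarrow> x ! (n + 1 + n * n + s b)"
proof -
  have "term_val s [Var 4, One, Prod 4 4, Var b] = n + 1 + n * n + s b"
    by (simp add: term_val_def assms)
  then show ?thesis unfolding bound_f_def using assms by (subst eval_input_bit) (simp_all add: len_x)
qed

lemma eval_value_f:
  assumes "s 4 = n" "s 5 = l" "s i < n" "s b < l"
  shows "eval (pair_input x y) (value_f i b) s \<longleftrightarrow> y ! (s i * l + s b)"
proof -
  have "term_val s [Prod i 5, Var b] = s i * l + s b" by (simp add: term_val_def assms)
  then show ?thesis
    unfolding value_f_def using assms index_less[OF assms(3,4)]
    by (subst eval_witness_bit) (simp_all add: len_y)
qed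

lemma eval_label_f:
  assumes "s 4 = n" "s 5 = l" "s i < n" "s a < n"
  shows "eval (pair_input x y) (label_f i a) s \<longleftrightarrow> y ! (n * l + s i * n + s a)"
proof -
  have "term_val s [Prod 4 5, Prod i 4, Var a] = n * l + s i * n + s a" by (simp add: term_val_def assms)
  then show ?thesis
    unfolding label_f_def using assms index_less[OF assms(3,4)]
    by (subst eval_witness_bit) (simp_all add: len_y)
qed

lemma eval_input_f:
  assumes "s 4 = n" "s 5 = l"
  shows "eval (pair_input x y) input_f s \<longleftrightarrow> valid_input x n l"
proof -
  let ?w = "pair_input x y"
  note [simp] = eval_Exb eval_Allb assms bounds
  have 1: "eval ?w (Allb 6 4 (input_bit [Var 6])) s \<longleftrightarrow> (\<forall>i<n. x ! i)"
    by (simp add: eval_input_bit term_val_def len_x)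
  have 2: "eval ?w (input_bit [Var 4]) s \<longleftrightarrow> x ! n"
    by (simp add: eval_input_bit term_val_def len_x)
  have 3: "eval ?w (Less [] 5) s \<longleftrightarrow> 0 < l"
    by (simp add: term_val_def)
  have 4: "eval ?w (input_bit [Var 4, Prod 4 4, Var 5]) s \<longleftrightarrow> x ! (n + n * n + l)"
    by (simp add: eval_input_bit term_val_def len_x add.assoc)
  have 5: "eval ?w (Allb 6 4 (Neg (rel_f 6 6))) s \<longleftrightarrow> (\<forall>i<n. \<not> x ! (n + 1 + i * n + i))"
    by (simp add: eval_rel_f)
  have 6: "eval ?w (Allb 6 4 (Allb 7 4 (Allb 8 4 (Imp (And (rel_f 6 7) (rel_f 7 8)) (rel_f 6 8))))) s \<longleftrightarrow>
      (\<forall>i<n. \<forall>j<n. \<forall>k<n. x ! (n + 1 + i * n + j) \<and> x ! (n + 1 + j * n + k) \<longrightarrow> x ! (n + 1 + i * n + k))"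
    by (simp add: eval_rel_f)
  show ?thesis
    unfolding input_f_def valid_input_def eval.simps(3,4) 1 2 3 4 5 6 by (simp only: len_x simp_thms)
qed

lemma eval_witness_f:
  assumes "s 4 = n" "s 5 = l"
  shows "eval (pair_input x y) witness_f s \<longleftrightarrow> valid_witness x n l y"
proof -
  let ?w = "pair_input x y"
  note [simp] = eval_Exb eval_Allb assms bounds
  have less: "eval ?w (less_f (value_f i) (value_f j)) s' \<longleftrightarrow>
      bits_less l (\<lambda>b. y ! (s' i * l + b)) (\<lambda>b. y ! (s' j * l + b))"
    if "i \<in> {6, 7}" "j \<in> {6, 7}" "s' 4 = n" "s' 5 = l" "s' i < n" "s' j < n" for i j s'
    using that by (intro eval_less_f) (auto simp: eval_value_f)
  have less_bound: "eval ?w (less_f (value_f 6) bound_f) s' \<longleftrightarrow>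
      bits_less l (\<lambda>b. y ! (s' 6 * l + b)) (\<lambda>b. x ! (n + 1 + n * n + b))"
    if "s' 4 = n" "s' 5 = l" "s' 6 < n" for s'
    using that by (intro eval_less_f) (auto simp: eval_value_f eval_bound_f)
  have 1: "eval ?w (Allb 6 4 (less_f (value_f 6) bound_f)) s \<longleftrightarrow>
      (\<forall>i<n. bits_less l (\<lambda>b. y ! (i * l + b)) (\<lambda>b. x ! (n + 1 + n * n + b)))"
    by (simp add: less_bound)
  have 2: "eval ?w (Allb 6 4 (Allb 7 4 (Imp (rel_f 6 7) (Neg (less_f (value_f 7) (value_f 6)))))) s \<longleftrightarrow>
      (\<forall>i<n. \<forall>j<n. x ! (n + 1 + i * n + j) \<longrightarrow>
        \<not> bits_less l (\<lambda>b. y ! (j * l + b)) (\<lambda>b. y ! (i * l + b)))"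
    by (simp add: less eval_rel_f)
  have 3: "eval ?w (Allb 6 4 (Exb 7 4 (label_f 6 7))) s \<longleftrightarrow> (\<forall>i<n. \<exists>a<n. y ! (n * l + i * n + a))"
    by (simp add: eval_label_f cong: conj_cong)
  have 4: "eval ?w (Allb 6 4 (Allb 7 4 (Allb 8 4
        (Imp (Less [Var 7] 8) (Neg (And (label_f 6 7) (label_f 6 8))))))) s \<longleftrightarrow>
      (\<forall>i<n. \<forall>a<n. \<forall>b<n. a < b \<longrightarrow> \<not> (y ! (n * l + i * n + a) \<and> y ! (n * l + i * n + b)))"
    by (simp add: eval_label_f term_val_def)
  have 5: "eval ?w (Allb 6 4 (Allb 7 4 (Allb 8 4
        (Imp (Less [Var 6] 7) (Neg (And (label_f 6 8) (label_f 7 8))))))) s \<longleftrightarrow>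
      (\<forall>i<n. \<forall>j<n. \<forall>a<n. i < j \<longrightarrow> \<not> (y ! (n * l + i * n + a) \<and> y ! (n * l + j * n + a)))"
    by (simp add: eval_label_f term_val_def)
  have 6: "eval ?w (Exb 6 4 (Exb 7 4 (And (rel_f 6 7)
            (And (Allb 8 5 (Iff (value_f 6 8) (value_f 7 8)))
                 (Exb 8 4 (Exb 9 4 (And (Less [Var 9] 8) (And (label_f 6 8) (label_f 7 9))))))))) s \<longleftrightarrow>
      (\<exists>i<n. \<exists>j<n. x ! (n + 1 + i * n + j) \<and> (\<forall>b<l. y ! (i * l + b) = y ! (j * l + b)) \<and>
        (\<exists>a<n. \<exists>b<n. b < a \<and> y ! (n * l + i * n + a) \<and> y ! (n * l + j * n + b)))"
    by (simp add: eval_rel_f eval_value_f eval_label_f term_val_def cong: conj_cong)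
  show ?thesis
    unfolding witness_f_def valid_witness_def eval.simps(4) 1 2 3 4 5 6 by (simp only: len_y simp_thms)
qed

end

text \<open>Validity on the right implies the length equations, and \<open>size_f\<close> asserts
  them on the left, so the bit formulas are read only where their meaning is established. Both n and
  l are at most the length of the input, so the range of \<open>Ex\<close> loses nothing.\<close>

lemma eval_verifier_f:
  "eval (pair_input x y) verifier_f s \<longleftrightarrow> (\<exists>n l. valid_input x n l \<and> valid_witness x n l y)"
proof -
  let ?w = "pair_input x y"
  have "eval ?w (And size_f (And input_f witness_f)) (s(4 := n, 5 := l)) \<longleftrightarrow>
      valid_input x n l \<and> valid_witness x n l y" for n l
  proof -
    have "valid_input x n l \<and> valid_witness x n l y \<Longrightarrow>
        length x = n + 1 + n * n + l \<and> length y = n * l + n * n"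
      unfolding valid_input_def valid_witness_def by blast
    moreover have s: "(s(4 := n, 5 := l)) 4 = n" "(s(4 := n, 5 := l)) 5 = l" by simp_all
    ultimately show ?thesis
      using eval_size_f[of "s(4 := n, 5 := l)" n l x y, OF s]
        eval_input_f[of x n l y "s(4 := n, 5 := l)"] eval_witness_f[of x n l y "s(4 := n, 5 := l)"] s
      unfolding eval.simps(4) by blast
  qed
  then have "eval ?w verifier_f s \<longleftrightarrow>
      (\<exists>n\<le>length ?w. \<exists>l\<le>length ?w. valid_input x n l \<and> valid_witness x n l y)"
    by (simp only: verifier_f_def eval.simps(5))
  moreover have "n \<le> length ?w \<and> l \<le> length ?w" if "valid_input x n l" for n l
  proof -
    have "length x = n + 1 + n * n + l" using that unfolding valid_input_def by blast
    then show ?thesis by (simp add: length_pair_input)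
  qed
  ultimately show ?thesis by blast
qed

section \<open>Membership in \#P\<close>

theorem theorem1p12:
  shows "(\<forall>(X :: 'a::infinite set) r t. finite_poset X r \<and> 1 \<le> t \<longrightarrow> 0 \<le> zeta (X, r, t)) \<and>
         in_sharpP represents (zeta :: 'a set \<times> 'a rel \<times> nat \<Rightarrow> int)"
proof (intro conjI allI impI)
  fix X :: "'a set" and r and t :: nat
  assume "finite_poset X r \<and> 1 \<le> t"
  then show "0 \<le> zeta (X, r, t)" by (simp add: zeta_eq_card_violations)
next
  define R where "R x y \<longleftrightarrow> (\<exists>n l. valid_input x n l \<and> valid_witness x n l y)" for x y
  define F where "F x = card {y. R x y}" for x
  have "polytime_decidable R"
    using polytime_decidable_fm[OF scoped_verifier_f] by (simp add: eval_verifier_f R_def[abs_def])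
  moreover have "polynomially_balanced R"
    unfolding polynomially_balanced_def
  \<comment> \<open>The polynomial is N + N^2: the matrix part n * n of a witness is at most the
    length N of the input, and the part n * l at most its square.\<close>
  proof (intro exI[of _ "[:0, 1, 1:]"] allI impI)
    fix x y assume "R x y"
    then obtain n l where "valid_input x n l" "valid_witness x n l y" unfolding R_def by blast
    then have x: "length x = n + 1 + n * n + l" and y: "length y = n * l + n * n"
      unfolding valid_input_def valid_witness_def by blast+
    have "n * l \<le> length x * length x" by (rule mult_le_mono) (simp_all add: x)
    then show "length y \<le> poly [:0, 1, 1:] (length x)" using x y by (simp add: algebra_simps)
  qed
  ultimately have "F \<in> sharpP" unfolding sharpP_def F_def by blast
  moreover have "int (F w) = zeta i" if rep: "represents w i" for w and i :: "'a set \<times> 'a rel \<times> nat"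
  proof -
    obtain X r t where i: "i = (X, r, t)" by (cases i)
    then obtain xs where X: "finite_poset X r" "1 \<le> t" and xs: "distinct xs" "set xs = X" "w = encode xs r t"
      using rep by (auto simp: represents_def)
    \<comment> \<open>Uniqueness of n and l removes the existential quantifiers, so witnesses for
      different sizes cannot be mixed in one count.\<close>
    have "R w y \<longleftrightarrow> valid_witness w (length xs) (length (binary t)) y" for y
      using valid_input_encode[of xs r t] valid_input_unique X xs unfolding R_def by metis
    then have "F w = card (violations X r t)"
      using card_valid_witness[of xs r t] X xs by (simp add: F_def)
    then show ?thesis using zeta_eq_card_violations[OF X(1)] by (simp add: i)
  qed
  moreover have "F w = 0" if "\<nexists>i :: 'a set \<times> 'a rel \<times> nat. represents w i" for w
  proof -
    have "{y. R w y} = {}" using that valid_input_represents unfolding R_def by blast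
    then show ?thesis by (simp only: F_def card.empty)
  qed
  ultimately show "in_sharpP represents (zeta :: 'a set \<times> 'a rel \<times> nat \<Rightarrow> int)"
    unfolding in_sharpP_def by blast
qed

end
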